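(* Let $\mathcal{A}$ be an arrangement of (finitely many, linear) hyperplanes in $\mathbb{R}^d$. Then for every $0\leq j\leq d$, $$\sum_{F\in \mathcal{R}_j(\mathcal{A})} P_F(t) = (-1)^j\chi_{\mathcal{A},j}(-t),$$ where $P_F(t)=\sum_{k} v_k(F)t^k$. In terms of the intrinsic volumes: for $0\leq k\leq j$, $$\sum_{F\in \mathcal{R}_j(\mathcal{A})} v_k(F) = (-1)^{j-k} a_{jk},$$ where $a_{jk}$ is the coefficient of $t^k$ in $\chi_{\mathcal{A},j}(t)$.
   Context: Polyhedral cones: a polyhedral cone $C\subseteq\mathbb{R}^d$ is a finite intersection of closed half-spaces bounded by linear hyperplanes (so $\mathbb{R}^d$ and linear subspaces are included). A face of $C$ is either $C$ itself or a set $C\cap H$ with $H$ a linear hyperplane such that $C$ lies in one of the two closed half-spaces of $H$. $\dim F$ is the dimension of the linear span of $F$, $\operatorname{relint}(F)$ is the interior of $F$ in its linear span, and $\mathcal{F}_k(C)$ is the set of $k$-dimensional faces of $C$. Intrinsic volumes: for a polyhedral cone $C\subseteq\mathbb{R}^d$ let $\Pi_C$ be the Euclidean nearest-point projection onto $C$ and $g$ a standard Gaussian vector in $\mathbb{R}^d$. The $k$-th intrinsic volume of $C$ is $v_k(C)=\sum_{F\in\mathcal{F}_k(C)}\mathbb{P}\{\Pi_C(g)\in\operatorname{relint}(F)\}$, $0\le k\le d$. Arrangements: for a finite set $\mathcal{A}=\{H_1,\dots,H_n\}$ of linear hyperplanes in $\mathbb{R}^d$, the intersection lattice is $\mathcal{L}(\mathcal{A})=\{\bigcap_{i\in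 I}H_i : I\subseteq\{1,\dots,n\}\}$ (with $I=\emptyset$ giving $\mathbb{R}^d$), partially ordered by reverse inclusion, with Möbius function $\mu$: $\mu(L,L)=1$; $\mu(\tilde L,L)=0$ if $\tilde L\not\supseteq L$; and $\mu(\tilde L,L)=-\sum_{\tilde L\supseteq M\supsetneq L,\ M\in\mathcal{L}(\mathcal{A})}\mu(\tilde L,M)$ if $\tilde L\supsetneq L$. Let $\mathcal{L}_j(\mathcal{A})=\{L\in\mathcal{L}(\mathcal{A}):\dim L=j\}$. The $j$th-level characteristic polynomial is $$\chi_{\mathcal{A},j}(t)=\sum_{\tilde L\in\mathcal{L}_j(\mathcal{A})}\ \sum_{L\in\mathcal{L}(\mathcal{A})}\mu(\tilde L,L)\,t^{\dim L}.$$ $\mathcal{R}(\mathcal{A})$ is the set of polyhedral cones that are closures of the connected components of $\mathbb{R}^d\setminus\bigcup_{H\in\mathcal{A}}H$, and $\mathcal{R}_j(\mathcal{A})=\bigcup_{C\in\mathcal{R}(\mathcal{A})}\mathcal{F}_j(C)$ (a set, so each cone is counted once). *)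

theory Defs
  imports
    "HOL-Probability.Probability"
    "HOL-Computational_Algebra.Polynomial"
begin

subsection \<open>Polyhedral cones and their faces\<close>

definition linear_hyperplane :: "'a::euclidean_space set \<Rightarrow> bool" where
  "linear_hyperplane H \<longleftrightarrow> (\<exists>a. a \<noteq> 0 \<and> H = {x. a \<bullet> x = 0})"

definition polyhedral_cone :: "'a::euclidean_space set \<Rightarrow> bool" where
  "polyhedral_cone C \<longleftrightarrow>
     (\<exists>N. finite N \<and> 0 \<notin> N \<and> C = (\<Inter>a\<in>N. {x. a \<bullet> x \<le> 0}))"

text \<open>Replacing \<open>a\<close> by \<open>- a\<close> covers both half-spaces of a hyperplane.\<close>

definition cone_face :: "'a::euclidean_space set \<Rightarrow> 'a set \<Rightarrow> bool" where
  "cone_face F C \<longleftrightarrow>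
     F = C \<or> (\<exists>a. a \<noteq> 0 \<and> C \<subseteq> {x. a \<bullet> x \<le> 0} \<and> F = C \<inter> {x. a \<bullet> x = 0})"

definition cone_faces :: "nat \<Rightarrow> 'a::euclidean_space set \<Rightarrow> 'a set set" where
  "cone_faces k C = {F. cone_face F C \<and> dim F = k}"

text \<open>
  The library's \<open>rel_interior\<close> is relative to the affine hull. Cones and their faces contain 0,
  so for them it is the interior in the linear span.
\<close>

lemma rel_interior_eq_interior_of_span:
  fixes S :: "'a::euclidean_space set"
  assumes "0 \<in> S"
  shows "rel_interior S = top_of_set (span S) interior_of S"
  using assms by (auto simp: rel_interior_def interior_of_def affine_hull_span_0 hull_inc)

lemma cone_face_contains_0:
  assumes "polyhedral_cone C" "cone_face F C"
  shows "0 \<in> F"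
  using assms by (auto simp: polyhedral_cone_def cone_face_def)

subsection \<open>Intrinsic volumes\<close>

definition std_gaussian :: "'a::euclidean_space measure" where
  "std_gaussian = density lborel (\<lambda>x. ennreal (\<Prod>b\<in>Basis. std_normal_density (x \<bullet> b)))"

lemma prob_space_std_gaussian: "prob_space (std_gaussian :: 'a::euclidean_space measure)"
proof
  have 1: "(\<integral>\<^sup>+ x. ennreal (std_normal_density x) \<partial>lborel) = 1"
    using prob_space.emeasure_space_1[OF prob_space_normal_density[of 1 0]]
    by (simp add: emeasure_density)
  have "emeasure std_gaussian (space (std_gaussian :: 'a measure))
      = (\<integral>\<^sup>+ x. (\<Prod>b\<in>Basis. ennreal (std_normal_density (x \<bullet> b))) \<partial>(lborel :: 'a measure))"
    by (simp add: std_gaussian_def emeasure_density prod_ennreal)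
  also have "\<dots> = 1"
    using nn_integral_lborel_prod[of "\<lambda>_::'a. \<lambda>x. ennreal (std_normal_density x)"] 1 by simp
  finally show "emeasure std_gaussian (space (std_gaussian :: 'a measure)) = 1" .
qed

definition intrinsic_volume :: "nat \<Rightarrow> 'a::euclidean_space set \<Rightarrow> real" where
  "intrinsic_volume k C =
     (\<Sum>F\<in>cone_faces k C. measure std_gaussian {g. closest_point C g \<in> rel_interior F})"

definition intrinsic_volume_poly :: "'a::euclidean_space set \<Rightarrow> real poly" where
  "intrinsic_volume_poly C = (\<Sum>k\<le>DIM('a). monom (intrinsic_volume k C) k)"

subsection \<open>Linear hyperplane arrangements\<close>

definition hyperplane_arrangement :: "'a::euclidean_space set set \<Rightarrow> bool" where
  "hyperplane_arrangement A \<longleftrightarrow> finite A \<and> (\<forall>H\<in>A. linear_hyperplane H)"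

definition intersection_lattice :: "'a::euclidean_space set set \<Rightarrow> 'a set set" where
  "intersection_lattice A = Inter ` Pow A"

lemma finite_intersection_lattice: "finite A \<Longrightarrow> finite (intersection_lattice A)"
  by (simp add: intersection_lattice_def)

text \<open>
  The recursion is well-founded only because the lattice is finite; for an infinite \<open>A\<close>,
  which is not an arrangement, the value is the dummy 0.
\<close>

function moebius :: "'a::euclidean_space set set \<Rightarrow> 'a set \<Rightarrow> 'a set \<Rightarrow> int" where
  "moebius A K L =
     (if infinite A then 0
      else if K = L then 1
      else if L \<subset> K then - (\<Sum>M\<in>{M \<in> intersection_lattice A. L \<subset> M \<and> M \<subseteq> K}. moebius A K M)
      else 0)"
  by pat_completeness auto
termination
proof (relation "Wellfounded.measure (\<lambda>(A, K, L). card {M \<in> intersection_lattice A. L \<subset> M})", goal_cases)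
  case 1
  show ?case by simp
next
  case (2 A K L M)
  then have "{N \<in> intersection_lattice A. M \<subset> N} \<subset> {N \<in> intersection_lattice A. L \<subset> N}"
    by auto
  with 2 show ?case
    by (auto intro!: psubset_card_mono simp: finite_intersection_lattice)
qed

declare moebius.simps [simp del]

definition level_char_poly :: "'a::euclidean_space set set \<Rightarrow> nat \<Rightarrow> real poly" where
  "level_char_poly A j =
     (\<Sum>K\<in>{K \<in> intersection_lattice A. dim K = j}.
        \<Sum>L\<in>intersection_lattice A. monom (of_int (moebius A K L)) (dim L))"

definition regions :: "'a::euclidean_space set set \<Rightarrow> 'a set set" where
  "regions A = closure ` components (- \<Union>A)"

definition region_faces :: "'a::euclidean_space set set \<Rightarrow> nat \<Rightarrow> 'a set set" where
  "region_faces A j = (\<Union>C\<in>regions A. cone_faces j C)"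

lemma polyhedral_cone_region:
  assumes A: "hyperplane_arrangement A" and C: "C \<in> regions A"
  shows "polyhedral_cone C"
proof -
  obtain n where n: "\<And>H. H \<in> A \<Longrightarrow> n H \<noteq> 0 \<and> H = {x. n H \<bullet> x = 0}"
    using A unfolding hyperplane_arrangement_def linear_hyperplane_def by metis
  then have n0: "n H \<noteq> 0" and nH: "y \<in> H \<longleftrightarrow> n H \<bullet> y = 0" if "H \<in> A" for H y
    using that by auto
  obtain x where x: "x \<notin> \<Union>A" and Cx: "C = closure (connected_component_set (- \<Union>A) x)"
    using C by (auto simp: regions_def components_def)
  define N where "N = (\<lambda>H. - sgn (n H \<bullet> x) *\<^sub>R n H) ` A"
  define P where "P = {y. \<forall>a\<in>N. a \<bullet> y < 0}"
  let ?K = "connected_component_set (- \<Union>A) x"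
  have nx: "n H \<bullet> x \<noteq> 0" if "H \<in> A" for H
    using nH[OF that] x that by blast
  have fin: "finite N" "0 \<notin> N"
    using A n0 nx by (auto simp: N_def hyperplane_arrangement_def sgn_zero_iff)
  have xP: "x \<in> P"
    using nx by (auto simp: P_def N_def sgn_if not_less order_le_less)
  have N_H: "a \<bullet> y = 0 \<Longrightarrow> y \<in> \<Union>A" if "a \<in> N" for a y
    using that nH nx by (auto simp: N_def sgn_zero_iff)
  have H_N: "y \<in> \<Union>A \<Longrightarrow> \<exists>a\<in>N. a \<bullet> y = 0" for y
    using nH by (auto simp: N_def)
  have "convex P"
  proof -
    have "P = (\<Inter>a\<in>N. {y. a \<bullet> y < 0})" by (auto simp: P_def)
    then show ?thesis by (auto intro: convex_INT convex_halfspace_lt)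
  qed
  moreover have "P \<subseteq> - \<Union>A"
    using H_N by (fastforce simp: P_def)
  ultimately have PK: "P \<subseteq> ?K"
    using xP by (simp add: connected_component_maximal convex_connected)
  have KP: "?K \<subseteq> P"
  proof
    fix y assume y: "y \<in> ?K"
    show "y \<in> P"
    proof (rule ccontr)
      assume "y \<notin> P"
      then obtain a where a: "a \<in> N" "a \<bullet> y \<ge> 0" by (auto simp: P_def not_less)
      have "x \<in> ?K" using x by simp
      moreover have "a \<bullet> x \<le> 0" using xP a by (auto simp: P_def less_imp_le)
      ultimately obtain z where z: "z \<in> ?K" "a \<bullet> z = 0"
        using connected_ivt_hyperplane[of ?K x y a 0] y a by auto
      then show False
        using N_H[OF a(1)] connected_component_subset[of "- \<Union>A" x] by blast
    qed
  qed
  let ?Q = "\<Inter>a\<in>N. {y. a \<bullet> y \<le> 0}"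
  have "closure P \<subseteq> ?Q"
    by (rule closure_minimal) (auto simp: P_def less_imp_le intro!: closed_INT closed_halfspace_le)
  moreover have "?Q \<subseteq> closure P"
  proof
    fix y assume y: "y \<in> ?Q"
    have "(\<lambda>m. y + (1 / real (Suc m)) *\<^sub>R x) \<longlonglongrightarrow> y + 0 *\<^sub>R x"
      by (intro tendsto_intros LIMSEQ_Suc[OF lim_1_over_n])
    moreover have "y + (1 / real (Suc m)) *\<^sub>R x \<in> P" for m
    proof -
      have "a \<bullet> y + (1 / real (Suc m)) * (a \<bullet> x) < 0" if "a \<in> N" for a
        using that y xP
        by (intro add_nonpos_neg mult_pos_neg) (auto simp: P_def)
      then show ?thesis
        by (auto simp: P_def inner_add_right simp del: of_nat_Suc)
    qed
    ultimately show "y \<in> closure P"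
      unfolding closure_sequential
      by (intro exI[of _ "\<lambda>m. y + (1 / real (Suc m)) *\<^sub>R x"]) (simp del: of_nat_Suc)
  qed
  ultimately have "C = ?Q" using Cx PK KP by auto
  then show ?thesis using fin by (auto simp: polyhedral_cone_def)
qed

end

theory Submission
  imports Defs
begin

text \<open>
  The direction space at \<open>p \<in> C\<close>, consisting of all \<open>v\<close> with \<open>p \<plusminus> e v \<in> C\<close> for small \<open>e > 0\<close>, is the
  span of the face of \<open>C\<close> with \<open>p\<close> in its relative interior, so \<open>v\<^sub>k(C)\<close> is the probability that
  the direction space at the projection of a Gaussian vector has dimension \<open>k\<close>. This description
  is local, and comparing projections onto \<open>C\<close> and onto the pieces cut off by a hyperplane \<open>H\<close>
  shows \<open>v\<^sub>k(C \<inter> H\<^sup>+) + v\<^sub>k(C \<inter> H\<^sup>-) = v\<^sub>k(C) + v\<^sub>k(C \<inter> H)\<close>, pointwise outside a null set.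

  Hence the sum of \<open>v\<^sub>k\<close> over the closed cells into which a set \<open>A\<close> of hyperplanes cuts a
  subspace \<open>K\<close> satisfies the deletion-restriction recursion of the signed count of the
  \<open>B \<subseteq> A\<close> with \<open>dim (K \<inter> \<Inter>B) = k\<close>. By Whitney's theorem this count is the inner sum of the
  \<open>j\<close>th-level characteristic polynomial, provided that \<open>A\<close> is reduced to the hyperplanes not
  containing \<open>K\<close>. Finally, each \<open>j\<close>-face of a region is a closed cell of exactly one
  \<open>j\<close>-dimensional \<open>K\<close> in the lattice, namely of its span.
\<close>

subsection \<open>Polyhedral cones and direction spaces\<close>

text \<open>Gives access to the theory of polyhedra and their faces. For the converse, a defining
  inequality \<open>a \<bullet> x \<le> b\<close> of \<open>C\<close> has \<open>b \<ge> 0\<close>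
  because \<open>0 \<in> C\<close>, and it holds at all nonnegative multiples of a point of
  \<open>C\<close>, which forces \<open>a \<bullet> x \<le> 0\<close>.\<close>

lemma polyhedral_cone_iff:
  "polyhedral_cone C \<longleftrightarrow> polyhedron C \<and> cone C \<and> C \<noteq> {}"
proof
  assume "polyhedral_cone C"
  then obtain N where N: "finite N" "C = (\<Inter>a\<in>N. {x. a \<bullet> x \<le> 0})"
    by (auto simp: polyhedral_cone_def)
  have "polyhedron C"
    unfolding N(2) using N(1) by (intro polyhedron_Inter) (auto simp: polyhedron_halfspace_le)
  moreover have "cone C"
    by (auto simp: N(2) cone_def mult_nonneg_nonpos)
  moreover have "0 \<in> C"
    by (simp add: N(2))
  ultimately show "polyhedron C \<and> cone C \<and> C \<noteq> {}"
    by blast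
next
  assume C: "polyhedron C \<and> cone C \<and> C \<noteq> {}"
  then have 0: "0 \<in> C"
    using cone_contains_0 by blast
  obtain F where F: "finite F" "C = \<Inter>F" "\<forall>h\<in>F. \<exists>a b. a \<noteq> 0 \<and> h = {x. a \<bullet> x \<le> b}"
    using C unfolding polyhedron_def by blast
  then obtain a b where ab: "\<And>h. h \<in> F \<Longrightarrow> a h \<noteq> 0" "\<And>h. h \<in> F \<Longrightarrow> h = {x. a h \<bullet> x \<le> b h}"
    by metis
  have b: "b h \<ge> 0" if "h \<in> F" for h
  proof -
    have "0 \<in> h" using that 0 F(2) by blast
    then show ?thesis using ab(2)[OF that] by (metis inner_zero_right mem_Collect_eq)
  qed
  have "C = (\<Inter>h\<in>F. {x. a h \<bullet> x \<le> 0})"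
  proof safe
    fix x h assume x: "x \<in> C" and h: "h \<in> F"
    show "a h \<bullet> x \<le> 0"
    proof (rule ccontr)
      assume *: "\<not> a h \<bullet> x \<le> 0"
      \<comment> \<open>This multiple of \<open>x\<close> would give the value
        \<open>b h + 1\<close>, which exceeds the bound \<open>b h\<close>.\<close>
      define c where "c = (b h + 1) / (a h \<bullet> x)"
      have "c \<ge> 0" using * b[OF h] by (simp add: c_def)
      then have "c *\<^sub>R x \<in> C" using x C by (simp add: cone_def)
      then have "c *\<^sub>R x \<in> h" using F(2) h by blast
      then have "c * (a h \<bullet> x) \<le> b h" using ab(2)[OF h] by (metis inner_scaleR_right mem_Collect_eq)
      then show False using * by (simp add: c_def)
    qed
  next
    fix x assume "x \<in> (\<Inter>h\<in>F. {x. a h \<bullet> x \<le> 0})"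
    then have "x \<in> h" if "h \<in> F" for h
      using that b[OF that] ab(2)[OF that] by fastforce
    then show "x \<in> C" using F(2) by blast
  qed
  then have "C = (\<Inter>n\<in>a`F. {x. n \<bullet> x \<le> 0})" by simp
  then show "polyhedral_cone C"
    unfolding polyhedral_cone_def using F(1) ab(1)
    by (intro exI[of _ "a ` F"]) auto
qed

lemma polyhedral_coneD:
  assumes "polyhedral_cone C"
  shows "polyhedron C" "cone C" "C \<noteq> {}" "0 \<in> C" "convex C" "closed C"
  using assms cone_contains_0
  by (auto simp: polyhedral_cone_iff polyhedron_imp_closed polyhedron_imp_convex)

text \<open>Faces of polyhedra are exposed, and a supporting hyperplane touching a cone passes
  through the origin: doubling a contact point gives \<open>2 * b \<le> b\<close>, and
  \<open>0 \<in> C\<close> gives \<open>0 \<le> b\<close>. The empty set is a face for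
  \<open>face_of\<close> but not for \<open>cone_face\<close>.\<close>

lemma cone_face_iff:
  assumes C: "polyhedral_cone C"
  shows "cone_face F C \<longleftrightarrow> F face_of C \<and> F \<noteq> {}"
proof
  assume F: "cone_face F C"
  then have "F face_of C"
    unfolding cone_face_def using polyhedral_coneD(5)[OF C]
    by (auto simp: face_of_refl intro!: face_of_Int_supporting_hyperplane_le)
  then show "F face_of C \<and> F \<noteq> {}"
    using cone_face_contains_0[OF C F] by blast
next
  assume F: "F face_of C \<and> F \<noteq> {}"
  then have "F exposed_face_of C"
    using exposed_face_of_polyhedron polyhedral_coneD(1)[OF C] by blast
  then obtain a b where ab: "C \<subseteq> {x. a \<bullet> x \<le> b}" "F = C \<inter> {x. a \<bullet> x = b}"
    unfolding exposed_face_of_def by blast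
  obtain x where x: "x \<in> F" using F by blast
  have "2 *\<^sub>R x \<in> C"
    using x ab(2) polyhedral_coneD(2)[OF C] by (simp add: cone_def)
  then have "2 * (a \<bullet> x) \<le> b" using ab(1) by (metis inner_scaleR_right mem_Collect_eq subsetD)
  moreover have "a \<bullet> x = b" using x ab(2) by blast
  moreover have "0 \<le> b" using ab(1) polyhedral_coneD(4)[OF C] by auto
  ultimately have "b = 0" by simp
  \<comment> \<open>With \<open>a = 0\<close> the exposed face is \<open>C\<close> itself, the first
    alternative of \<open>cone_face\<close>.\<close>
  with ab show "cone_face F C"
    unfolding cone_face_def by (cases "a = 0") auto
qed

lemma face_of_contains_0:
  assumes "polyhedral_cone C" "F face_of C" "F \<noteq> {}"
  shows "0 \<in> F"
  using assms cone_face_contains_0 cone_face_iff by blast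

text \<open>The witness is the smallest face containing \<open>p\<close>. If \<open>p\<close> were
  on its relative boundary, it would lie in a facet of it, which is a smaller face of
  \<open>S\<close>.\<close>

lemma polyhedron_point_in_rel_interior_face:
  fixes S :: "'a::euclidean_space set"
  assumes S: "polyhedron S" and p: "p \<in> S"
  obtains F where "F face_of S" "p \<in> rel_interior F"
proof -
  define F where "F = \<Inter>{T. T face_of S \<and> p \<in> T}"
  have F: "F face_of S"
    unfolding F_def using p face_of_refl[OF polyhedron_imp_convex[OF S]]
    by (intro face_of_Inter) auto
  have pF: "p \<in> F" by (auto simp: F_def)
  have polyF: "polyhedron F" using face_of_polyhedron_polyhedron[OF S F] .
  have "p \<in> rel_interior F"
  proof (rule ccontr)
    assume "p \<notin> rel_interior F"
    then have "p \<in> rel_frontier F"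
      using pF closure_subset by (auto simp: rel_frontier_def)
    then obtain G where G: "G facet_of F" "p \<in> G"
      using rel_frontier_of_polyhedron[OF polyF] by blast
    then have "G face_of S" using F face_of_trans facet_of_imp_face_of by blast
    then have "F \<subseteq> G" using G by (auto simp: F_def)
    then show False using G facet_of_imp_subset facet_of_irrefl by (metis subset_antisym)
  qed
  then show thesis using F that by blast
qed

section \<open>Direction spaces and spans of faces\<close>

definition face_space :: "'a::real_vector set \<Rightarrow> 'a \<Rightarrow> 'a set" where
  "face_space C p = {v. \<exists>e>0. p + e *\<^sub>R v \<in> C \<and> p - e *\<^sub>R v \<in> C}"

text \<open>A two-sided direction makes \<open>p\<close> the midpoint of a segment in
  \<open>C\<close>, so the face property puts its endpoints into \<open>F\<close>. Conversely, a
  ball around \<open>p\<close> within \<open>span F\<close> stays in \<open>F\<close>.\<close>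

lemma face_space_eq_span:
  fixes C :: "'a::euclidean_space set"
  assumes C: "convex C" and F: "F face_of C" and p: "p \<in> rel_interior F" and 0: "0 \<in> F"
  shows "face_space C p = span F"
proof (intro equalityI subsetI)
  have pF: "p \<in> F" using p rel_interior_subset by blast
  fix v assume "v \<in> face_space C p"
  then obtain e where e: "e > 0" "p + e *\<^sub>R v \<in> C" "p - e *\<^sub>R v \<in> C"
    by (auto simp: face_space_def)
  show "v \<in> span F"
  proof (cases "v = 0")
    case True then show ?thesis by (simp add: span_zero)
  next
    case False
    have "p + e *\<^sub>R v \<noteq> p - e *\<^sub>R v"
    proof
      assume "p + e *\<^sub>R v = p - e *\<^sub>R v"
      then have "(2 * e) *\<^sub>R v = 0"
        by (simp add: algebra_simps flip: scaleR_2)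
      then show False using False e by simp
    qed
    moreover have "p = midpoint (p + e *\<^sub>R v) (p - e *\<^sub>R v)"
      by (simp add: midpoint_def flip: scaleR_2)
    ultimately have "p \<in> open_segment (p + e *\<^sub>R v) (p - e *\<^sub>R v)"
      by (metis midpoint_in_open_segment)
    then have "p + e *\<^sub>R v \<in> F"
      using F e pF unfolding face_of_def by blast
    then have "(1/e) *\<^sub>R ((p + e *\<^sub>R v) - p) \<in> span F"
      using pF by (intro span_scale span_diff span_base)
    then show ?thesis using e by simp
  qed
next
  fix v assume v: "v \<in> span F"
  have pF: "p \<in> F" using p rel_interior_subset by blast
  obtain d where d: "d > 0" "ball p d \<inter> span F \<subseteq> F"
    using p 0 unfolding mem_rel_interior_ball by (auto simp: affine_hull_span_0 hull_inc)
  \<comment> \<open>The summand 1 keeps the denominator positive when \<open>v = 0\<close>.\<close>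
  define e where "e = d / (2 * (norm v + 1))"
  have e: "e > 0" "e * norm v < d"
    using d(1) by (auto simp: e_def field_simps add_pos_nonneg add_strict_increasing2)
  have "p + e *\<^sub>R v \<in> F" "p - e *\<^sub>R v \<in> F"
    using e d(2) v pF by (auto intro!: subsetD[OF d(2)] span_add span_diff span_scale intro: span_base simp: dist_norm)
  then show "v \<in> face_space C p"
    using e(1) F face_of_imp_subset unfolding face_space_def by blast
qed

lemma face_space_polyhedral_cone:
  assumes C: "polyhedral_cone C" and F: "F face_of C" and p: "p \<in> rel_interior F"
  shows "face_space C p = span F"
proof -
  have "F \<noteq> {}" using p rel_interior_subset by blast
  then show ?thesis
    using face_space_eq_span[OF polyhedral_coneD(5)[OF C] F p] face_of_contains_0[OF C F] by blast
qed

subsection \<open>Intrinsic volumes through direction spaces\<close>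

lemma finite_cone_faces: "polyhedral_cone C \<Longrightarrow> finite (cone_faces k C)"
  using finite_polyhedron_faces[OF polyhedral_coneD(1)]
  by (rule finite_subset[rotated]) (auto simp: cone_faces_def cone_face_iff)

lemma sets_std_gaussian [simp, measurable_cong]: "sets std_gaussian = sets borel"
  by (simp add: std_gaussian_def)

lemma space_std_gaussian [simp]: "space std_gaussian = UNIV"
  by (simp add: std_gaussian_def)

text \<open>The projection is continuous, and a relative interior is a difference of two closed
  sets.\<close>

lemma closest_point_in_rel_interior_measurable:
  fixes C :: "'a::euclidean_space set"
  assumes C: "polyhedral_cone C" and F: "convex F"
  shows "{g. closest_point C g \<in> rel_interior F} \<in> sets borel"
proof -
  have 1: "closest_point C \<in> borel_measurable borel"
    using polyhedral_coneD[OF C]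
    by (intro borel_measurable_continuous_onI continuous_on_closest_point) auto
  have "rel_interior F = closure F - rel_frontier F"
    using rel_interior_subset_closure by (auto simp: rel_frontier_def)
  then have "rel_interior F \<in> sets borel"
    by (metis borel_closed closed_closure closed_rel_frontier sets.Diff)
  with 1 show ?thesis
    by (metis measurable_sets_borel vimage_def)
qed

lemma face_space_closest_point_eq:
  fixes C :: "'a::euclidean_space set"
  assumes C: "polyhedral_cone C"
  shows "{g. dim (face_space C (closest_point C g)) = k} =
     (\<Union>F\<in>cone_faces k C. {g. closest_point C g \<in> rel_interior F})"
proof (intro equalityI subsetI)
  fix g assume g: "g \<in> {g. dim (face_space C (closest_point C g)) = k}"
  have "closest_point C g \<in> C"
    using polyhedral_coneD[OF C] closest_point_in_set by blast
  then obtain F where F: "F face_of C" "closest_point C g \<in> rel_interior F"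
    using polyhedron_point_in_rel_interior_face[OF polyhedral_coneD(1)[OF C]] by blast
  have "F \<in> cone_faces k C"
    using g F rel_interior_subset[of F] face_space_polyhedral_cone[OF C F] C
    by (auto simp: cone_faces_def cone_face_iff)
  then show "g \<in> (\<Union>F\<in>cone_faces k C. {g. closest_point C g \<in> rel_interior F})"
    using F by blast
next
  fix g assume "g \<in> (\<Union>F\<in>cone_faces k C. {g. closest_point C g \<in> rel_interior F})"
  then show "g \<in> {g. dim (face_space C (closest_point C g)) = k}"
    using face_space_polyhedral_cone[OF C] C by (auto simp: cone_faces_def cone_face_iff)
qed

lemma face_space_closest_point_measurable:
  fixes C :: "'a::euclidean_space set"
  assumes C: "polyhedral_cone C"
  shows "{g. dim (face_space C (closest_point C g)) = k} \<in> sets borel"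
  unfolding face_space_closest_point_eq[OF C]
  using closest_point_in_rel_interior_measurable[OF C] finite_cone_faces[OF C] C
  by (intro sets.finite_UN) (auto simp: cone_faces_def cone_face_iff face_of_imp_convex)

text \<open>Distinct faces have disjoint relative interiors, so the sum over faces is the
  probability of a union. The right-hand side no longer mentions faces, so different cones can be
  compared at a single \<open>g\<close>.\<close>

lemma intrinsic_volume_eq:
  fixes C :: "'a::euclidean_space set"
  assumes C: "polyhedral_cone C"
  shows "intrinsic_volume k C =
    measure std_gaussian {g. dim (face_space C (closest_point C g)) = k}"
proof -
  interpret prob_space "std_gaussian :: 'a measure" by (rule prob_space_std_gaussian)
  have "disjoint_family_on (\<lambda>F. {g. closest_point C g \<in> rel_interior F}) (cone_faces k C)"
    unfolding disjoint_family_on_def using face_of_eq C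
    by (fastforce simp: cone_faces_def cone_face_iff)
  moreover have "(\<lambda>F. {g. closest_point C g \<in> rel_interior F}) ` cone_faces k C \<subseteq> sets std_gaussian"
    using closest_point_in_rel_interior_measurable[OF C] C
    by (auto simp: cone_faces_def cone_face_iff face_of_imp_convex)
  ultimately show ?thesis
    unfolding intrinsic_volume_def face_space_closest_point_eq[OF C]
    by (intro finite_measure_finite_Union[symmetric] finite_cone_faces[OF C])
qed

section \<open>Null sets of the Gaussian measure\<close>

lemma AE_std_gaussianI:
  assumes "AE x in lborel. P x"
  shows "AE x in std_gaussian. P x"
  unfolding std_gaussian_def using assms by (subst AE_density) auto

lemma AE_std_gaussian_not_in_hyperplane:
  fixes m :: "'a::euclidean_space"
  assumes "m \<noteq> 0"
  shows "AE g in std_gaussian. m \<bullet> g \<noteq> 0"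
proof (rule AE_std_gaussianI)
  have "negligible {x. m \<bullet> x = 0}"
    using assms by (intro negligible_hyperplane) auto
  then have "{x. m \<bullet> x = 0} \<in> null_sets lebesgue"
    by (simp add: negligible_iff_null_sets)
  moreover have "{x. m \<bullet> x = 0} \<in> sets borel"
    by (intro borel_closed closed_hyperplane)
  ultimately have "{x. m \<bullet> x = 0} \<in> null_sets lborel"
    by (simp add: null_sets_completion_iff)
  then show "AE x in lborel. m \<bullet> x \<noteq> 0"
    by (rule AE_I'[where N="{x. m \<bullet> x = 0}"]) auto
qed

subsection \<open>Cutting a cone by a hyperplane\<close>

lemma polyhedral_cone_Int:
  "polyhedral_cone C \<Longrightarrow> polyhedral_cone D \<Longrightarrow> polyhedral_cone (C \<inter> D)"
  using polyhedral_coneD(4)[of C] polyhedral_coneD(4)[of D]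
  by (auto simp: polyhedral_cone_iff cone_def)

lemma polyhedral_cone_halfspace:
  "polyhedral_cone {x. 0 \<le> n \<bullet> x}" "polyhedral_cone {x. n \<bullet> x \<le> 0}" "polyhedral_cone {x. n \<bullet> x = 0}"
proof -
  have "polyhedral_cone {x. n \<bullet> x \<le> 0}" for n :: 'a
    unfolding polyhedral_cone_def
    by (rule exI[of _ "{n} - {0}"]) auto
  moreover have "{x. (-n) \<bullet> x \<le> 0} = {x. 0 \<le> n \<bullet> x}" "{x. n \<bullet> x \<le> 0} \<inter> {x. 0 \<le> n \<bullet> x} = {x. n \<bullet> x = 0}"
    by auto
  ultimately
  show "polyhedral_cone {x. 0 \<le> n \<bullet> x}" "polyhedral_cone {x. n \<bullet> x \<le> 0}" "polyhedral_cone {x. n \<bullet> x = 0}"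
    using polyhedral_cone_Int[of "{x. n \<bullet> x \<le> 0}" "{x. 0 \<le> n \<bullet> x}"] by metis+
qed

text \<open>
  If \<open>p\<close>, the projection of \<open>g\<close>, lies in the relative interior of \<open>F\<close>, then \<open>g - p\<close> is orthogonal to
  \<open>span F\<close>. So \<open>n \<bullet> p = y \<bullet> g\<close> for the component \<open>y\<close> of \<open>n\<close> in \<open>span F\<close>, and this vanishes with positive
  probability only if \<open>y = 0\<close>.
\<close>

lemma AE_face_space_closest_point_in_hyperplane:
  fixes C :: "'a::euclidean_space set"
  assumes C: "polyhedral_cone C"
  shows "AE g in std_gaussian. n \<bullet> closest_point C g = 0 \<longrightarrow>
           (\<forall>v\<in>face_space C (closest_point C g). n \<bullet> v = 0)"
proof -
  have "AE g in std_gaussian. closest_point C g \<in> rel_interior F \<longrightarrow> n \<bullet> closest_point C g = 0 \<longrightarrow>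
          (\<forall>v\<in>span F. n \<bullet> v = 0)" if F: "F face_of C" for F
  proof (cases "\<forall>v\<in>span F. n \<bullet> v = 0")
    case True
    then show ?thesis by simp
  next
    case False
    obtain y z where y: "y \<in> span F" and z: "\<And>w. w \<in> span F \<Longrightarrow> orthogonal z w" and n: "n = y + z"
      using orthogonal_subspace_decomp_exists[of F n] by metis
    have "y \<noteq> 0" using False z n by (auto simp: orthogonal_def)
    then have "AE g in std_gaussian. y \<bullet> g \<noteq> 0"
      by (rule AE_std_gaussian_not_in_hyperplane)
    then show ?thesis
    proof eventually_elim
      case (elim g)
      define p where "p = closest_point C g"
      have False if p: "p \<in> rel_interior F" and np: "n \<bullet> p = 0"
      proof -
        have "y \<in> face_space C p"
          using face_space_polyhedral_cone[OF C F p] y by simp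
        then obtain e where e: "e > 0" "p + e *\<^sub>R y \<in> C" "p - e *\<^sub>R y \<in> C"
          by (auto simp: face_space_def)
        \<comment> \<open>The obtuse-angle property of the projection holds in opposite directions,
          so \<open>g - p\<close> is orthogonal to \<open>y\<close>.\<close>
        have "(g - p) \<bullet> (e *\<^sub>R y) \<le> 0" "(g - p) \<bullet> - (e *\<^sub>R y) \<le> 0"
          using closest_point_dot[of C "p + e *\<^sub>R y" g] closest_point_dot[of C "p - e *\<^sub>R y" g]
            polyhedral_coneD(5,6)[OF C] e(2,3) by (simp_all add: p_def)
        then have "e * ((g - p) \<bullet> y) = 0" by simp
        then have "g \<bullet> y = p \<bullet> y"
          using e(1) by (simp add: inner_diff_left)
        then have "y \<bullet> g = y \<bullet> p"
          by (metis inner_commute)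
        moreover have "p \<in> span F"
          using p rel_interior_subset[of F] by (blast intro: span_base)
        then have "z \<bullet> p = 0"
          using z by (simp add: orthogonal_def)
        ultimately show False
          using np elim by (simp add: n inner_add_left)
      qed
      then show ?case unfolding p_def by blast
    qed
  qed
  \<comment> \<open>There are finitely many faces, so the exceptional null sets can be
    united.\<close>
  then have "AE g in std_gaussian. \<forall>F\<in>{F. F face_of C}. closest_point C g \<in> rel_interior F \<longrightarrow>
      n \<bullet> closest_point C g = 0 \<longrightarrow> (\<forall>v\<in>span F. n \<bullet> v = 0)"
    using finite_polyhedron_faces[OF polyhedral_coneD(1)[OF C]] by (intro AE_finite_allI) simp_all
  then show ?thesis
  proof eventually_elim
    case (elim g)
    have "closest_point C g \<in> C"
      using polyhedral_coneD[OF C] closest_point_in_set by blast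
    then obtain F where F: "F face_of C" "closest_point C g \<in> rel_interior F"
      using polyhedron_point_in_rel_interior_face[OF polyhedral_coneD(1)[OF C]] by blast
    show ?case
      unfolding face_space_polyhedral_cone[OF C F] using elim F by blast
  qed
qed

section \<open>Projections and direction spaces under a cut\<close>

lemma closest_point_Int:
  fixes S :: "'a::euclidean_space set"
  assumes "convex S" "closed S" "convex T" "closed T" "closest_point S g \<in> S \<inter> T"
  shows "closest_point (S \<inter> T) g = closest_point S g"
  using assms by (intro closest_point_unique[symmetric])
    (auto intro: convex_Int closest_point_le)

text \<open>If the nearest point \<open>q\<close> were strictly on the far side, the segment from
  \<open>q\<close> to the projection \<open>p\<close> would cross the hyperplane at a point of
  \<open>S\<close> strictly closer to \<open>g\<close>, by convexity of the distance. So
  \<open>q\<close> lies on the hyperplane and is nearest there too.\<close>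

lemma closest_point_beyond_hyperplane:
  fixes S :: "'a::euclidean_space set"
  assumes S: "convex S" "closed S" and p: "n \<bullet> closest_point S g > 0"
    and ne: "S \<inter> {x. n \<bullet> x \<le> 0} \<noteq> {}"
  shows "closest_point (S \<inter> {x. n \<bullet> x \<le> 0}) g = closest_point (S \<inter> {x. n \<bullet> x = 0}) g"
proof -
  let ?T = "S \<inter> {x. n \<bullet> x \<le> 0}"
  define p where "p = closest_point S g"
  define q where "q = closest_point ?T g"
  have pS: "p \<in> S" using S ne closest_point_in_set[of S] by (auto simp: p_def)
  have T: "convex ?T" "closed ?T"
    using S by (auto intro!: convex_Int convex_halfspace_le closed_Int closed_halfspace_le)
  have qT: "q \<in> ?T" using T ne closest_point_in_set unfolding q_def by blast
  have "n \<bullet> q = 0"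
  proof (rule ccontr)
    assume "n \<bullet> q \<noteq> 0"
    then have nq: "n \<bullet> q < 0" using qT by auto
    have np: "n \<bullet> p > 0" using p by (simp add: p_def)
    \<comment> \<open>The parameter at which the segment from \<open>q\<close> to \<open>p\<close>
      meets the hyperplane.\<close>
    define t where "t = - (n \<bullet> q) / (n \<bullet> p - n \<bullet> q)"
    have t: "0 < t" "t < 1" using nq np by (auto simp: t_def field_simps)
    define z where "z = (1 - t) *\<^sub>R q + t *\<^sub>R p"
    have "z \<in> S" using S(1) qT pS t by (auto simp: z_def intro!: convexD)
    moreover have "n \<bullet> z = n \<bullet> q + t * (n \<bullet> p - n \<bullet> q)"
      by (simp add: z_def inner_add_right algebra_simps)
    then have "n \<bullet> z = 0" using nq np by (simp add: t_def)
    ultimately have "dist g q \<le> dist g z"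
      using closest_point_le[OF T(2)] by (auto simp: q_def)
    moreover have "dist g p < dist g q"
      using closest_point_lt[OF S, of q g] qT nq np by (cases "q = p") (auto simp: p_def)
    moreover have "dist g z \<le> (1 - t) * dist g q + t * dist g p"
    proof -
      have "g - z = (1 - t) *\<^sub>R (g - q) + t *\<^sub>R (g - p)" by (simp add: z_def algebra_simps)
      then have "norm (g - z) \<le> norm ((1 - t) *\<^sub>R (g - q)) + norm (t *\<^sub>R (g - p))"
        by (metis norm_triangle_ineq)
      then show ?thesis using t by (simp add: dist_norm)
    qed
    moreover have "t * dist g p < t * dist g q"
      using t calculation by simp
    ultimately show False by (simp add: algebra_simps)
  qed
  then have "q \<in> S \<inter> {x. n \<bullet> x = 0}" using qT by simp
  moreover have "convex (S \<inter> {x. n \<bullet> x = 0})" "closed (S \<inter> {x. n \<bullet> x = 0})"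
    using S by (auto intro!: convex_Int convex_hyperplane closed_Int closed_hyperplane)
  ultimately show ?thesis
    using closest_point_le[OF T(2), of _ g]
    unfolding q_def[symmetric] by (intro closest_point_unique) auto
qed

text \<open>The half-space constraint is inactive near \<open>p\<close>, so shortening the step
  suffices.\<close>

lemma face_space_Int_halfspace:
  fixes S :: "'a::real_inner set"
  assumes "convex S" "p \<in> S" "n \<bullet> p > 0"
  shows "face_space (S \<inter> {x. 0 \<le> n \<bullet> x}) p = face_space S p"
proof
  show "face_space S p \<subseteq> face_space (S \<inter> {x. 0 \<le> n \<bullet> x}) p"
  proof
    fix v assume "v \<in> face_space S p"
    then obtain e where e: "e > 0" "p + e *\<^sub>R v \<in> S" "p - e *\<^sub>R v \<in> S"
      by (auto simp: face_space_def)
    \<comment> \<open>Small enough that the step changes \<open>n \<bullet> p\<close> by at most its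
      own size; the summand 1 avoids division by zero.\<close>
    define d where "d = min e ((n \<bullet> p) / (\<bar>n \<bullet> v\<bar> + 1))"
    have "(n \<bullet> p) / (\<bar>n \<bullet> v\<bar> + 1) * \<bar>n \<bullet> v\<bar> \<le> n \<bullet> p"
      using assms(3) by (simp add: field_simps)
    moreover have "d * \<bar>n \<bullet> v\<bar> \<le> (n \<bullet> p) / (\<bar>n \<bullet> v\<bar> + 1) * \<bar>n \<bullet> v\<bar>"
      by (intro mult_right_mono) (auto simp: d_def)
    ultimately have "d * \<bar>n \<bullet> v\<bar> \<le> n \<bullet> p" by linarith
    moreover have d: "0 < d" "d \<le> e"
      using e assms(3) by (auto simp: d_def)
    ultimately have "\<bar>d * (n \<bullet> v)\<bar> \<le> n \<bullet> p" by (simp add: abs_mult)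
    then have "0 \<le> n \<bullet> (p + d *\<^sub>R v)" "0 \<le> n \<bullet> (p - d *\<^sub>R v)"
      by (auto simp: inner_add_right inner_diff_right)
    \<comment> \<open>Shorter steps are convex combinations of \<open>p\<close> and the longer
      ones.\<close>
    moreover have "p + d *\<^sub>R v = (1 - d/e) *\<^sub>R p + (d/e) *\<^sub>R (p + e *\<^sub>R v)"
      "p - d *\<^sub>R v = (1 - d/e) *\<^sub>R p + (d/e) *\<^sub>R (p - e *\<^sub>R v)"
      using e(1) by (auto simp: algebra_simps)
    then have "p + d *\<^sub>R v \<in> S" "p - d *\<^sub>R v \<in> S"
      using e d assms(1,2) convexD[OF assms(1), of p _ "1 - d/e" "d/e"] by auto
    ultimately show "v \<in> face_space (S \<inter> {x. 0 \<le> n \<bullet> x}) p"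
      using d(1) by (auto simp: face_space_def)
  qed
qed (auto simp: face_space_def)

text \<open>A segment centred at a boundary point of a half-space stays in the half-space only if it
  stays in the boundary.\<close>

lemma face_space_Int_halfspace_boundary:
  assumes "n \<bullet> p = 0"
  shows "face_space (S \<inter> {x. n \<bullet> x \<le> 0}) p = face_space (S \<inter> {x. n \<bullet> x = 0}) p"
proof -
  have "p + e *\<^sub>R v \<in> {x. n \<bullet> x \<le> 0} \<and> p - e *\<^sub>R v \<in> {x. n \<bullet> x \<le> 0} \<longleftrightarrow>
      p + e *\<^sub>R v \<in> {x. n \<bullet> x = 0} \<and> p - e *\<^sub>R v \<in> {x. n \<bullet> x = 0}" for v e
    using assms by (simp add: inner_add_right inner_diff_right) (metis antisym mult_eq_0_iff order_refl)
  then show ?thesis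
    unfolding face_space_def by blast
qed

text \<open>For projections falling on the hyperplane; \<open>T\<close> will be either half-space or
  the hyperplane itself.\<close>

lemma face_space_Int_superset_hyperplane:
  assumes "n \<bullet> p = 0" "\<forall>v\<in>face_space S p. n \<bullet> v = 0" "{x. n \<bullet> x = 0} \<subseteq> T"
  shows "face_space (S \<inter> T) p = face_space S p"
proof
  show "face_space S p \<subseteq> face_space (S \<inter> T) p"
  proof
    fix v assume v: "v \<in> face_space S p"
    then have "n \<bullet> v = 0" using assms(2) by blast
    then have "p + e *\<^sub>R v \<in> T" "p - e *\<^sub>R v \<in> T" for e
      using assms(1,3) by (auto intro!: subsetD[OF assms(3)] simp: inner_add_right inner_diff_right)
    then show "v \<in> face_space (S \<inter> T) p"
      using v by (auto simp: face_space_def)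
  qed
qed (auto simp: face_space_def)

text \<open>The piece of \<open>C\<close> containing the projection looks like \<open>C\<close> near
  it. For the other piece the projection moves onto the hyperplane, and there the piece and the
  section have the same direction space.\<close>

lemma face_space_closest_point_split:
  fixes C :: "'a::euclidean_space set"
  assumes C: "polyhedral_cone C" and n: "n \<bullet> closest_point C g > 0"
  shows "face_space (C \<inter> {x. 0 \<le> n \<bullet> x}) (closest_point (C \<inter> {x. 0 \<le> n \<bullet> x}) g) = face_space C (closest_point C g)"
    and "face_space (C \<inter> {x. n \<bullet> x \<le> 0}) (closest_point (C \<inter> {x. n \<bullet> x \<le> 0}) g) =
         face_space (C \<inter> {x. n \<bullet> x = 0}) (closest_point (C \<inter> {x. n \<bullet> x = 0}) g)"
proof -
  note D = polyhedral_coneD[OF C]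
  have p: "closest_point C g \<in> C" using D closest_point_in_set by blast
  have "closest_point (C \<inter> {x. 0 \<le> n \<bullet> x}) g = closest_point C g"
    using D n p polyhedral_coneD(5,6)[OF polyhedral_cone_halfspace(1)[of n]] by (intro closest_point_Int) auto
  then show "face_space (C \<inter> {x. 0 \<le> n \<bullet> x}) (closest_point (C \<inter> {x. 0 \<le> n \<bullet> x}) g) = face_space C (closest_point C g)"
    using face_space_Int_halfspace[OF D(5) p n] by simp
  have q: "closest_point (C \<inter> {x. n \<bullet> x \<le> 0}) g = closest_point (C \<inter> {x. n \<bullet> x = 0}) g"
    using D n by (intro closest_point_beyond_hyperplane) auto
  have "closest_point (C \<inter> {x. n \<bullet> x = 0}) g \<in> C \<inter> {x. n \<bullet> x = 0}"
    using polyhedral_coneD[OF polyhedral_cone_Int[OF C polyhedral_cone_halfspace(3)[of n]]]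
      closest_point_in_set by blast
  then show "face_space (C \<inter> {x. n \<bullet> x \<le> 0}) (closest_point (C \<inter> {x. n \<bullet> x \<le> 0}) g) =
         face_space (C \<inter> {x. n \<bullet> x = 0}) (closest_point (C \<inter> {x. n \<bullet> x = 0}) g)"
    using q face_space_Int_halfspace_boundary by (metis (mono_tags, lifting) IntD2 mem_Collect_eq)
qed

text \<open>Integrates an almost sure identity of indicators. When the projection is off the
  hyperplane, the four indicators agree in pairs; when it is on it, almost surely all four
  agree.\<close>

lemma intrinsic_volume_split:
  fixes C :: "'a::euclidean_space set"
  assumes C: "polyhedral_cone C"
  shows "intrinsic_volume k (C \<inter> {x. 0 \<le> n \<bullet> x}) + intrinsic_volume k (C \<inter> {x. n \<bullet> x \<le> 0}) =
     intrinsic_volume k C + intrinsic_volume k (C \<inter> {x. n \<bullet> x = 0})"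
proof -
  interpret prob_space "std_gaussian :: 'a measure" by (rule prob_space_std_gaussian)
  define V where "V = (\<lambda>D::'a set. {g. dim (face_space D (closest_point D g)) = k})"
  define Cp where "Cp = C \<inter> {x. 0 \<le> n \<bullet> x}"
  define Cm where "Cm = C \<inter> {x. n \<bullet> x \<le> 0}"
  define C0 where "C0 = C \<inter> {x. n \<bullet> x = 0}"
  have pc: "polyhedral_cone Cp" "polyhedral_cone Cm" "polyhedral_cone C0"
    unfolding Cp_def Cm_def C0_def by (intro polyhedral_cone_Int C polyhedral_cone_halfspace)+
  have meas: "V D \<in> sets std_gaussian" if "polyhedral_cone D" for D
    using face_space_closest_point_measurable[OF that] by (simp add: V_def)
  have "AE g in std_gaussian. indicator (V Cp) g + indicator (V Cm) g =
      (indicator (V C) g + indicator (V C0) g :: real)"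
    using AE_face_space_closest_point_in_hyperplane[OF C, of n]
  proof eventually_elim
    case (elim g)
    define p where "p = closest_point C g"
    consider "n \<bullet> p > 0" | "- n \<bullet> p > 0" | "n \<bullet> p = 0" by fastforce
    then show ?case
    proof cases
      case 1
      then show ?thesis
        using face_space_closest_point_split[OF C, of n g]
        by (simp add: p_def V_def Cp_def Cm_def C0_def indicator_def)
    next
      \<comment> \<open>Negating \<open>n\<close> exchanges the two half-spaces.\<close>
      case 2
      then show ?thesis
        using face_space_closest_point_split[OF C, of "-n" g]
        by (simp add: p_def V_def Cp_def Cm_def C0_def indicator_def)
    next
      case 3
      have p: "p \<in> C" using polyhedral_coneD[OF C] closest_point_in_set by (auto simp: p_def)
      have T: "indicator (V (C \<inter> T)) g = (indicator (V C) g :: real)"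
        if "polyhedral_cone T" "{x. n \<bullet> x = 0} \<subseteq> T" for T
      proof -
        have "closest_point (C \<inter> T) g = p"
          unfolding p_def using polyhedral_coneD[OF C] polyhedral_coneD[OF that(1)] that(2) p 3
          by (intro closest_point_Int) (auto simp: p_def)
        then show ?thesis
          using face_space_Int_superset_hyperplane[OF 3 _ that(2), of C] 3 elim
          by (simp add: V_def indicator_def p_def)
      qed
      show ?thesis
        unfolding Cp_def Cm_def C0_def by (subst (1 2 3) T) (auto intro: polyhedral_cone_halfspace)
    qed
  qed
  then have "(\<integral>g. (indicator (V Cp) g + indicator (V Cm) g :: real) \<partial>std_gaussian) =
      (\<integral>g. (indicator (V C) g + indicator (V C0) g :: real) \<partial>std_gaussian)"
    by (intro integral_cong_AE borel_measurable_add borel_measurable_indicator meas pc C)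
  moreover have "(\<integral>g. (indicator (V D) g + indicator (V E) g :: real) \<partial>std_gaussian) = prob (V D) + prob (V E)"
    if "polyhedral_cone D" "polyhedral_cone E" for D E
  proof -
    have "integrable std_gaussian (indicator (V D) :: 'a \<Rightarrow> real)" "integrable std_gaussian (indicator (V E) :: 'a \<Rightarrow> real)"
      using meas[OF that(1)] meas[OF that(2)] by (auto simp: emeasure_eq_measure)
    then show ?thesis
      by (subst Bochner_Integration.integral_add) simp_all
  qed
  ultimately have "prob (V Cp) + prob (V Cm) = prob (V C) + prob (V C0)"
    using pc C by simp
  then show ?thesis
    using pc C by (simp add: intrinsic_volume_eq V_def Cp_def Cm_def C0_def)
qed

subsection \<open>Cells of a subspace cut by hyperplanes\<close>

definition normal :: "'a::euclidean_space set \<Rightarrow> 'a" where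
  "normal H = (SOME a. a \<noteq> 0 \<and> H = {x. a \<bullet> x = 0})"

lemma normal:
  assumes "linear_hyperplane H"
  shows "normal H \<noteq> 0" "H = {x. normal H \<bullet> x = 0}"
proof -
  have "normal H \<noteq> 0 \<and> H = {x. normal H \<bullet> x = 0}"
    unfolding normal_def using assms unfolding linear_hyperplane_def by (rule someI_ex)
  then show "normal H \<noteq> 0" "H = {x. normal H \<bullet> x = 0}"
    by blast+
qed

lemma mem_linear_hyperplane_iff: "linear_hyperplane H \<Longrightarrow> x \<in> H \<longleftrightarrow> normal H \<bullet> x = 0"
  using normal(2) by blast

lemma subspace_linear_hyperplane: "linear_hyperplane H \<Longrightarrow> subspace H"
  by (subst normal(2)) (auto simp: subspace_hyperplane)

text \<open>A sign vector is encoded as the set \<open>P\<close> of hyperplanes on whose positive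
  side the cell lies, so sums over sign vectors run over \<open>Pow A\<close>. The sides refer to
  the fixed choice \<open>normal\<close>.\<close>

definition cell :: "'a::euclidean_space set \<Rightarrow> 'a set set \<Rightarrow> 'a set set \<Rightarrow> 'a set" where
  "cell K A P = {x \<in> K. \<forall>H\<in>A. if H \<in> P then 0 < normal H \<bullet> x else normal H \<bullet> x < 0}"

definition closed_cell :: "'a::euclidean_space set \<Rightarrow> 'a set set \<Rightarrow> 'a set set \<Rightarrow> 'a set" where
  "closed_cell K A P = {x \<in> K. \<forall>H\<in>A. if H \<in> P then 0 \<le> normal H \<bullet> x else normal H \<bullet> x \<le> 0}"

lemma cellD: "x \<in> cell K A P \<Longrightarrow> H \<in> A \<Longrightarrow> if H \<in> P then 0 < normal H \<bullet> x else normal H \<bullet> x < 0"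
  by (simp add: cell_def)

lemma closed_cellD: "x \<in> closed_cell K A P \<Longrightarrow> H \<in> A \<Longrightarrow> if H \<in> P then 0 \<le> normal H \<bullet> x else normal H \<bullet> x \<le> 0"
  by (simp add: closed_cell_def)

lemma cell_subset_closed_cell: "cell K A P \<subseteq> closed_cell K A P"
  by (auto simp: cell_def closed_cell_def less_imp_le)

lemma cell_eq_Int: "cell K A P = K \<inter> cell UNIV A P"
  by (auto simp: cell_def)

lemma cell_eq_INT:
  "cell K A P = K \<inter> (\<Inter>H\<in>A. if H \<in> P then {x. 0 < normal H \<bullet> x} else {x. normal H \<bullet> x < 0})"
  by (auto simp: cell_def split: if_splits)

lemma closed_cell_eq_INT:
  "closed_cell K A P = K \<inter> (\<Inter>H\<in>A. if H \<in> P then {x. 0 \<le> normal H \<bullet> x} else {x. normal H \<bullet> x \<le> 0})"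
  by (auto simp: closed_cell_def split: if_splits)

lemma open_cell_UNIV: "finite A \<Longrightarrow> open (cell UNIV A P)"
  by (auto simp: cell_eq_INT open_halfspace_lt open_halfspace_gt intro!: open_INT)

lemma convex_cell: "convex K \<Longrightarrow> convex (cell K A P)"
  unfolding cell_eq_INT
  by (intro convex_Int convex_INT) (auto simp: convex_halfspace_lt convex_halfspace_gt)

lemma polyhedral_cone_subspace: "subspace K \<Longrightarrow> polyhedral_cone K"
  using subspace_0[of K]
  by (auto simp: polyhedral_cone_iff affine_imp_polyhedron subspace_imp_affine cone_def subspace_scale)

lemma polyhedral_cone_INT:
  assumes "finite I" "\<And>i. i \<in> I \<Longrightarrow> polyhedral_cone (f i)"
  shows "polyhedral_cone (\<Inter>i\<in>I. f i)"
  using assms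
  by (induction I) (auto intro: polyhedral_cone_Int polyhedral_cone_subspace[OF subspace_UNIV])

lemma polyhedral_cone_closed_cell:
  "subspace K \<Longrightarrow> finite A \<Longrightarrow> polyhedral_cone (closed_cell K A P)"
  unfolding closed_cell_eq_INT
  by (intro polyhedral_cone_Int polyhedral_cone_INT)
    (auto intro: polyhedral_cone_halfspace polyhedral_cone_subspace)

text \<open>Adding a small positive multiple of \<open>x\<close> to a point of the closed cell makes
  all weak inequalities strict. Without such an \<open>x\<close> the open cell is empty, while the
  closed one contains 0.\<close>

lemma closure_cell:
  assumes K: "subspace K" and A: "finite A" and x: "x \<in> cell K A P"
  shows "closure (cell K A P) = closed_cell K A P"
proof (intro antisym closure_minimal subsetI)
  show "closed (closed_cell K A P)"
    using polyhedral_cone_closed_cell[OF K A] by (rule polyhedral_coneD(6))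
  show "y \<in> closed_cell K A P" if "y \<in> cell K A P" for y
    using that cell_subset_closed_cell by blast
  fix y assume y: "y \<in> closed_cell K A P"
  have "(\<lambda>m. y + (1 / real (Suc m)) *\<^sub>R x) \<longlonglongrightarrow> y + 0 *\<^sub>R x"
    by (intro tendsto_intros LIMSEQ_Suc[OF lim_1_over_n])
  moreover have "y + (1 / real (Suc m)) *\<^sub>R x \<in> cell K A P" for m
  proof -
    have "y + (1 / real (Suc m)) *\<^sub>R x \<in> K"
      using x y K by (auto simp: cell_def closed_cell_def simp del: of_nat_Suc intro: subspace_add subspace_scale)
    moreover have "if H \<in> P then 0 < normal H \<bullet> (y + (1 / real (Suc m)) *\<^sub>R x)
        else normal H \<bullet> (y + (1 / real (Suc m)) *\<^sub>R x) < 0" if "H \<in> A" for H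
      using x y that
      by (auto simp: cell_def closed_cell_def inner_add_right simp del: of_nat_Suc
          intro!: add_nonneg_pos add_nonpos_neg mult_pos_neg divide_neg_pos)
    ultimately show ?thesis by (simp add: cell_def del: of_nat_Suc)
  qed
  ultimately show "y \<in> closure (cell K A P)"
    unfolding closure_sequential
    by (intro exI[of _ "\<lambda>m. y + (1 / real (Suc m)) *\<^sub>R x"]) (simp del: of_nat_Suc)
qed

text \<open>Finitely many strict inequalities make the cell relatively open in
  \<open>K\<close>.\<close>

lemma cell_perturb:
  assumes K: "subspace K" and A: "finite A" and x: "x \<in> cell K A P" and v: "v \<in> K"
  obtains e where "e > 0" "x + e *\<^sub>R v \<in> cell K A P" "x - e *\<^sub>R v \<in> cell K A P"
proof -
  have "x \<in> cell UNIV A P" using x by (auto simp: cell_def)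
  then obtain d where d: "d > 0" "ball x d \<subseteq> cell UNIV A P"
    using open_cell_UNIV[OF A] open_contains_ball by blast
  define e where "e = d / (2 * (norm v + 1))"
  have e: "e > 0" "e * norm v < d"
    using d(1) by (auto simp: e_def field_simps add_pos_nonneg add_strict_increasing2)
  have "x + e *\<^sub>R v \<in> ball x d" "x - e *\<^sub>R v \<in> ball x d"
    using e by (auto simp: dist_norm)
  moreover have "x + e *\<^sub>R v \<in> K" "x - e *\<^sub>R v \<in> K"
    using x v K by (auto simp: cell_def intro: subspace_add subspace_diff subspace_scale)
  ultimately show thesis
    using d(2) e(1) that cell_eq_Int[of K A P] by blast
qed

text \<open>
  If \<open>K\<close> lies in a member of \<open>A\<close>, all cells are empty while the closed cells are not. With the
  value 0 for empty cells, deletion-restriction needs no exception in this case.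
\<close>

definition cell_volume :: "nat \<Rightarrow> 'a::euclidean_space set \<Rightarrow> 'a set set \<Rightarrow> 'a set set \<Rightarrow> real" where
  "cell_volume k K A P = (if cell K A P = {} then 0 else intrinsic_volume k (closed_cell K A P))"

text \<open>The direction space at every point of \<open>K\<close> is \<open>K\<close>. This is the
  base case of the recursion.\<close>

lemma intrinsic_volume_subspace:
  fixes K :: "'a::euclidean_space set"
  assumes K: "subspace K"
  shows "intrinsic_volume k K = (if dim K = k then 1 else 0)"
proof -
  interpret prob_space "std_gaussian :: 'a measure" by (rule prob_space_std_gaussian)
  have p: "polyhedral_cone K" using polyhedral_cone_subspace[OF K] .
  have "face_space K p = K" if "p \<in> K" for p
  proof (intro equalityI subsetI)
    fix v assume "v \<in> face_space K p"
    then obtain e where e: "e > 0" "p + e *\<^sub>R v \<in> K" by (auto simp: face_space_def)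
    then have "(1/e) *\<^sub>R ((p + e *\<^sub>R v) - p) \<in> K"
      using K that by (intro subspace_scale subspace_diff)
    then show "v \<in> K" using e(1) by simp
  next
    fix v assume "v \<in> K"
    then show "v \<in> face_space K p"
      using K that by (auto simp: face_space_def intro!: exI[of _ 1] intro: subspace_add subspace_diff)
  qed
  moreover have "closest_point K g \<in> K" for g
    using polyhedral_coneD[OF p] closest_point_in_set by blast
  ultimately have "{g. dim (face_space K (closest_point K g)) = k} = (if dim K = k then UNIV else {})"
    by auto
  then show ?thesis
    using prob_space by (simp add: intrinsic_volume_eq[OF p])
qed

section \<open>Deletion and restriction\<close>

lemma dim_Int_linear_hyperplane:
  assumes K: "subspace K" and H: "linear_hyperplane H" and KH: "\<not> K \<subseteq> H"
  shows "dim K = Suc (dim (K \<inter> H))"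
proof -
  have "0 \<in> K \<inter> H"
    using K subspace_linear_hyperplane[OF H] by (simp add: subspace_0)
  then have "aff_dim (K \<inter> H) = aff_dim K - 1"
    using aff_dim_affine_Int_hyperplane[OF subspace_imp_affine[OF K], of "normal H" 0] KH
    by (simp flip: normal(2)[OF H]) blast
  then show ?thesis
    using aff_dim_subspace[OF K] aff_dim_subspace[OF subspace_inter[OF K subspace_linear_hyperplane[OF H]]]
    by simp
qed

text \<open>If \<open>H\<close> meets the open cell, all four open cells are nonempty and
  \<open>intrinsic_volume_split\<close> applies. Otherwise the connected cell lies on one side of
  \<open>H\<close>: the closed cell there is unchanged, and the other piece and the restriction
  count 0.\<close>

lemma cell_volume_insert:
  fixes K :: "'a::euclidean_space set"
  assumes K: "subspace K" and A: "finite A" and H: "linear_hyperplane H" "H \<notin> A"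
    and KH: "\<not> K \<subseteq> H" and P: "P \<subseteq> A"
  shows "cell_volume k K (insert H A) P + cell_volume k K (insert H A) (insert H P) =
     cell_volume k K A P + cell_volume k (K \<inter> H) A P"
proof -
  define n where "n = normal H"
  define U where "U = cell K A P"
  define D where "D = closed_cell K A P"
  note mem_H = mem_linear_hyperplane_iff[OF H(1)]
  have cells: "cell K (insert H A) P = U \<inter> {x. n \<bullet> x < 0}"
      "cell K (insert H A) (insert H P) = U \<inter> {x. 0 < n \<bullet> x}"
      "cell (K \<inter> H) A P = U \<inter> {x. n \<bullet> x = 0}"
    and closed: "closed_cell K (insert H A) P = D \<inter> {x. n \<bullet> x \<le> 0}"
      "closed_cell K (insert H A) (insert H P) = D \<inter> {x. 0 \<le> n \<bullet> x}"
      "closed_cell (K \<inter> H) A P = D \<inter> {x. n \<bullet> x = 0}"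
    using H P mem_H by (auto simp: cell_def closed_cell_def U_def D_def n_def split: if_splits)
  have D: "polyhedral_cone D"
    unfolding D_def using K A by (rule polyhedral_cone_closed_cell)
  show ?thesis
  proof (cases "U \<inter> {x. n \<bullet> x = 0} = {}")
    case False
    then obtain x where x: "x \<in> U" "n \<bullet> x = 0" by blast
    \<comment> \<open>A direction of \<open>K\<close> transversal to \<open>H\<close> leads from
      \<open>x\<close> to both sides of \<open>H\<close> within the cell.\<close>
    obtain y where y: "y \<in> K" "n \<bullet> y \<noteq> 0"
      using KH mem_H by (auto simp: n_def)
    obtain e where e: "e > 0" "x + e *\<^sub>R y \<in> U" "x - e *\<^sub>R y \<in> U"
      using cell_perturb[OF K A x(1)[unfolded U_def] y(1)] unfolding U_def by blast
    have "n \<bullet> (x + e *\<^sub>R y) = e * (n \<bullet> y)" "n \<bullet> (x - e *\<^sub>R y) = - (e * (n \<bullet> y))"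
      using x by (simp_all add: inner_add_right inner_diff_right)
    moreover have "e * (n \<bullet> y) > 0 \<or> e * (n \<bullet> y) < 0"
      using y(2) e(1) by (simp add: zero_less_mult_iff mult_less_0_iff neq_iff disj_commute)
    ultimately have "U \<inter> {x. n \<bullet> x < 0} \<noteq> {}" "U \<inter> {x. 0 < n \<bullet> x} \<noteq> {}"
      using e(2,3) by (auto simp: disjoint_iff)
    then show ?thesis
      unfolding cell_volume_def cells closed using x False intrinsic_volume_split[OF D, of k n]
      by (auto simp flip: U_def D_def)
  next
    case True
    have side: "U \<inter> {x. n \<bullet> x < 0} = {} \<or> U \<inter> {x. 0 < n \<bullet> x} = {}"
    proof (rule ccontr)
      assume "\<not> ?thesis"
      then obtain x y where "x \<in> U" "n \<bullet> x \<le> 0" "y \<in> U" "0 \<le> n \<bullet> y"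
        by (auto intro: less_imp_le)
      moreover have "connected U"
        unfolding U_def using K by (intro convex_connected convex_cell subspace_imp_convex)
      ultimately have "\<exists>z\<in>U. n \<bullet> z = 0"
        using connected_ivt_hyperplane[of U x y n 0] by blast
      then show False using True by blast
    qed
    \<comment> \<open>\<open>D\<close> is the closure of \<open>U\<close>, so a closed half-space
      containing \<open>U\<close> contains \<open>D\<close>.\<close>
    have one_side: "D \<inter> T = D" if "closed T" "U \<subseteq> T" "U \<noteq> {}" for T
    proof -
      have "D = closure U"
        unfolding D_def U_def using that closure_cell[OF K A, of _ P] by (auto simp: U_def)
      then show ?thesis using that closure_minimal by blast
    qed
    show ?thesis
    proof (cases "U = {}")
      case True
      then show ?thesis by (auto simp: cell_volume_def cells simp flip: U_def)
    next
      case False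
      from side show ?thesis
      proof
        assume *: "U \<inter> {x. n \<bullet> x < 0} = {}"
        then have "U \<subseteq> {x. 0 \<le> n \<bullet> x}" "U \<inter> {x. 0 < n \<bullet> x} = U"
          using True by force+
        with * show ?thesis
          unfolding cell_volume_def cells closed using True False one_side[OF closed_halfspace_ge]
          by (auto simp flip: U_def D_def)
      next
        assume *: "U \<inter> {x. 0 < n \<bullet> x} = {}"
        then have "U \<subseteq> {x. n \<bullet> x \<le> 0}" "U \<inter> {x. n \<bullet> x < 0} = U"
          using True by force+
        with * show ?thesis
          unfolding cell_volume_def cells closed using True False one_side[OF closed_halfspace_le]
          by (auto simp flip: U_def D_def)
      qed
    qed
  qed
qed

lemma sum_Pow_insert:
  assumes "finite A" "a \<notin> A"
  shows "(\<Sum>B\<in>Pow (insert a A). f B) = (\<Sum>B\<in>Pow A. f B + f (insert a B))"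
proof -
  have "inj_on (insert a) (Pow A)"
    using assms(2) by (auto simp: inj_on_def insert_ident)
  moreover have "Pow A \<inter> insert a ` Pow A = {}"
    using assms(2) by auto
  ultimately show ?thesis
    using assms(1) by (simp add: Pow_insert sum.union_disjoint sum.reindex sum.distrib)
qed

text \<open>\<open>K\<close> varies in the induction, since restriction to \<open>H\<close> replaces
  it by \<open>K \<inter> H\<close> and keeps \<open>A\<close>. The drop of the dimension by one
  matches the sign of the sets that contain \<open>H\<close>.\<close>

lemma sum_cell_volume:
  fixes K :: "'a::euclidean_space set"
  assumes A: "finite A" "\<And>H. H \<in> A \<Longrightarrow> linear_hyperplane H" and K: "subspace K"
  shows "(\<Sum>P\<in>Pow A. cell_volume k K A P) =
    (-1) ^ (dim K + k) * (\<Sum>B\<in>Pow A. if dim (K \<inter> \<Inter>B) = k then (-1) ^ card B else 0)"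
  using A K
proof (induction A arbitrary: K rule: finite_induct)
  case empty
  have "cell K {} {} = K" "closed_cell K {} {} = K"
    by (auto simp: cell_def closed_cell_def)
  then show ?case
    using empty subspace_0[of K]
    by (auto simp add: cell_volume_def intrinsic_volume_subspace simp flip: mult_2)
next
  case (insert H A)
  note H = insert.prems(1)[OF insertI1]
  let ?g = "\<lambda>K B. if dim (K \<inter> \<Inter>B) = k then (-1) ^ card B else (0::real)"
  have IH: "(\<Sum>P\<in>Pow A. cell_volume k K A P) = (-1) ^ (dim K + k) * (\<Sum>B\<in>Pow A. ?g K B)"
    if "subspace K" for K
    using insert.IH insert.prems(1) that by blast
  have g: "?g K (insert H B) = - ?g (K \<inter> H) B" if "B \<in> Pow A" for B
  proof -
    have "finite B" "H \<notin> B" using that insert.hyps finite_subset by blast+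
    then show ?thesis by (simp add: Int_assoc)
  qed
  have *: "(\<Sum>B\<in>Pow (insert H A). ?g K B) = (\<Sum>B\<in>Pow A. ?g K B) - (\<Sum>B\<in>Pow A. ?g (K \<inter> H) B)"
    unfolding sum_Pow_insert[OF insert.hyps] sum_subtractf[symmetric]
    by (intro sum.cong refl, subst g) auto
  show ?case
  proof (cases "K \<subseteq> H")
    \<comment> \<open>All cells are empty, and on the right the sets with and without
      \<open>H\<close> cancel.\<close>
    case True
    then have "cell K (insert H A) P = {}" for P
      using mem_linear_hyperplane_iff[OF H] by (auto simp: cell_def split: if_splits)
    moreover have "K \<inter> H = K" using True by blast
    ultimately show ?thesis
      unfolding * by (simp add: cell_volume_def)
  next
    case False
    have "(\<Sum>P\<in>Pow (insert H A). cell_volume k K (insert H A) P) =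
        (\<Sum>P\<in>Pow A. cell_volume k K A P) + (\<Sum>P\<in>Pow A. cell_volume k (K \<inter> H) A P)"
      unfolding sum_Pow_insert[OF insert.hyps] sum.distrib[symmetric]
      using cell_volume_insert[OF insert.prems(2) insert.hyps(1) H insert.hyps(2) False]
      by (intro sum.cong) auto
    then show ?thesis
      unfolding * using IH[OF insert.prems(2)] IH[OF subspace_inter[OF insert.prems(2) subspace_linear_hyperplane[OF H]]]
      by (simp add: dim_Int_linear_hyperplane[OF insert.prems(2) H False] right_diff_distrib)
  qed
qed

subsection \<open>The Moebius function and the characteristic polynomial\<close>

text \<open>Sets with and without a fixed element cancel in pairs.\<close>

lemma sum_Pow_minus_one_card:
  assumes "finite A" "A \<noteq> {}"
  shows "(\<Sum>B\<in>Pow A. (-1) ^ card B) = (0::int)"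
proof -
  obtain a A' where A': "A = insert a A'" "a \<notin> A'"
    using assms(2) by (metis ex_in_conv mk_disjoint_insert)
  then have fin: "finite A'" using assms(1) by simp
  have "(-1) ^ card B + (-1) ^ card (insert a B) = (0::int)" if "B \<in> Pow A'" for B
  proof -
    have "finite B" "a \<notin> B" using that A' fin finite_subset by blast+
    then show ?thesis by simp
  qed
  then show ?thesis
    unfolding A'(1) sum_Pow_insert[OF fin A'(2)] by (simp del: card_insert_disjoint)
qed

text \<open>The hyperplanes that properly cut \<open>K\<close>; those containing \<open>K\<close>
  would make every open cell of \<open>K\<close> empty.\<close>

definition transversal :: "'a set set \<Rightarrow> 'a set \<Rightarrow> 'a set set" where
  "transversal A K = {H \<in> A. \<not> K \<subseteq> H}"

lemma finite_transversal: "finite A \<Longrightarrow> finite (transversal A K)"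
  by (simp add: transversal_def)

lemma Int_Inter_in_intersection_lattice:
  assumes "K \<in> intersection_lattice A" "B \<subseteq> A"
  shows "K \<inter> \<Inter>B \<in> intersection_lattice A"
proof -
  obtain S where "S \<subseteq> A" "K = \<Inter>S"
    using assms(1) by (auto simp: intersection_lattice_def)
  then show ?thesis
    using assms(2) by (auto simp: intersection_lattice_def intro!: image_eqI[of _ _ "S \<union> B"])
qed

text \<open>
  The right-hand side satisfies the recursion of the Moebius function: for \<open>L \<subset> K\<close>, summing it over
  the interval from \<open>L\<close> to \<open>K\<close> gives an alternating sum over all sets of hyperplanes that
  contain \<open>L\<close> but not \<open>K\<close>, and there is at least one such hyperplane.
\<close>

lemma moebius_eq_sum_Pow:
  assumes "finite A" "K \<in> intersection_lattice A" "L \<in> intersection_lattice A"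
  shows "moebius A K L = (\<Sum>B\<in>{B \<in> Pow (transversal A K). K \<inter> \<Inter>B = L}. (-1) ^ card B)"
  using assms
proof (induction A K L rule: moebius.induct)
  case (1 A K L)
  let ?T = "transversal A K"
  let ?W = "\<lambda>M. \<Sum>B\<in>{B \<in> Pow ?T. K \<inter> \<Inter>B = M}. (-1) ^ card B :: int"
  note fin = finite_transversal[OF "1.prems"(1), of K]
  consider "K = L" | "L \<subset> K" | "K \<noteq> L" "\<not> L \<subset> K" by blast
  then show ?case
  proof cases
    case 1
    have "{B \<in> Pow ?T. K \<inter> \<Inter>B = L} = {{}}"
      using 1 by (auto simp: transversal_def)
    then show ?thesis
      using 1 "1.prems" by (simp add: moebius.simps)
  next
    case 3
    then have "{B \<in> Pow ?T. K \<inter> \<Inter>B = L} = {}" by auto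
    then show ?thesis
      using 3 "1.prems" by (subst moebius.simps) (simp only: sum.empty if_False not_True_eq_False)
  next
    case 2
    define I where "I = {M \<in> intersection_lattice A. L \<subseteq> M \<and> M \<subseteq> K}"
    define T where "T = {H \<in> ?T. L \<subseteq> H}"
    have finI: "finite I" using finite_intersection_lattice[OF "1.prems"(1)] by (simp add: I_def)
    obtain S where S: "S \<subseteq> A" "L = \<Inter>S"
      using "1.prems"(3) by (auto simp: intersection_lattice_def)
    \<comment> \<open>Some member of \<open>S\<close> does not contain \<open>K\<close>, as
      otherwise \<open>K \<subseteq> L\<close>.\<close>
    then have "T \<noteq> {}" using 2 by (auto simp: T_def transversal_def)
    moreover have finT: "finite T" using fin by (simp add: T_def)
    ultimately have "0 = (\<Sum>B\<in>Pow T. (-1) ^ card B :: int)"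
      by (simp add: sum_Pow_minus_one_card)
    also have "\<dots> = (\<Sum>M\<in>I. \<Sum>B\<in>{B \<in> Pow T. K \<inter> \<Inter>B = M}. (-1) ^ card B)"
    proof (rule sum.group[symmetric])
      show "(\<lambda>B. K \<inter> \<Inter>B) ` Pow T \<subseteq> I"
        using 2 Int_Inter_in_intersection_lattice[OF "1.prems"(2)]
        by (auto simp: I_def T_def transversal_def)
    qed (use finT finI in auto)
    also have "\<dots> = (\<Sum>M\<in>I. ?W M)"
    proof (rule sum.cong[OF refl])
      fix M assume "M \<in> I"
      \<comment> \<open>If \<open>K \<inter> \<Inter>B = M\<close> and
        \<open>L \<subseteq> M\<close>, every member of \<open>B\<close> contains
        \<open>L\<close>.\<close>
      then have "{B \<in> Pow T. K \<inter> \<Inter>B = M} = {B \<in> Pow ?T. K \<inter> \<Inter>B = M}"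
        by (auto simp: I_def T_def)
      then show "(\<Sum>B\<in>{B \<in> Pow T. K \<inter> \<Inter>B = M}. (-1) ^ card B) = ?W M" by simp
    qed
    also have "I = insert L {M \<in> intersection_lattice A. L \<subset> M \<and> M \<subseteq> K}"
      using 2 "1.prems" by (auto simp: I_def)
    also have "(\<Sum>M\<in>\<dots>. ?W M) = ?W L + (\<Sum>M\<in>{M \<in> intersection_lattice A. L \<subset> M \<and> M \<subseteq> K}. ?W M)"
      using finite_intersection_lattice[OF "1.prems"(1)] by (subst sum.insert) auto
    also have "(\<Sum>M\<in>{M \<in> intersection_lattice A. L \<subset> M \<and> M \<subseteq> K}. ?W M) =
        (\<Sum>M\<in>{M \<in> intersection_lattice A. L \<subset> M \<and> M \<subseteq> K}. moebius A K M)"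
      using 1 2 by (intro sum.cong) auto
    finally show ?thesis
      using 2 "1.prems"(1) by (subst moebius.simps) auto
  qed
qed

text \<open>Grouping the sets \<open>B\<close> by the flat \<open>K \<inter> \<Inter>B\<close>
  produces the Moebius values.\<close>

lemma coeff_level_char_poly:
  assumes A: "finite A"
  shows "coeff (level_char_poly A j) k =
    (\<Sum>K\<in>{K \<in> intersection_lattice A. dim K = j}.
       \<Sum>B\<in>Pow (transversal A K). if dim (K \<inter> \<Inter>B) = k then (-1) ^ card B else 0)"
proof -
  have "(\<Sum>L\<in>intersection_lattice A. if dim L = k then of_int (moebius A K L) else 0) =
      (\<Sum>B\<in>Pow (transversal A K). if dim (K \<inter> \<Inter>B) = k then (-1) ^ card B else (0::real))"
    if K: "K \<in> intersection_lattice A" for K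
  proof -
    have "(\<Sum>B\<in>Pow (transversal A K). if dim (K \<inter> \<Inter>B) = k then (-1) ^ card B else (0::real)) =
        (\<Sum>L\<in>intersection_lattice A. \<Sum>B\<in>{B \<in> Pow (transversal A K). K \<inter> \<Inter>B = L}.
           if dim (K \<inter> \<Inter>B) = k then (-1) ^ card B else 0)"
      using finite_intersection_lattice[OF A] finite_transversal[OF A] Int_Inter_in_intersection_lattice[OF K]
      by (intro sum.group[symmetric]) (auto simp: transversal_def)
    also have "\<dots> = (\<Sum>L\<in>intersection_lattice A. if dim L = k then of_int (moebius A K L) else 0)"
      using A K by (intro sum.cong refl) (auto simp: moebius_eq_sum_Pow)
    finally show ?thesis by simp
  qed
  then show ?thesis
    unfolding level_char_poly_def by (simp add: coeff_sum coeff_monom)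
qed

lemma degree_level_char_poly_le:
  fixes A :: "'a::euclidean_space set set"
  assumes "finite A"
  shows "degree (level_char_poly A j) \<le> DIM('a)"
  unfolding level_char_poly_def
  using finite_intersection_lattice[OF assms]
  by (intro degree_sum_le) (auto intro: order_trans[OF degree_monom_le dim_subset_UNIV])

subsection \<open>Faces of regions as closed cells\<close>

lemma cell_eqI:
  assumes "x \<in> cell K A P" "P \<subseteq> A"
  shows "P = {H \<in> A. 0 < normal H \<bullet> x}"
  using assms by (auto simp: cell_def split: if_splits)

lemma mem_cell_positive:
  assumes "x \<in> K" "\<And>H. H \<in> A \<Longrightarrow> normal H \<bullet> x \<noteq> 0"
  shows "x \<in> cell K A {H \<in> A. 0 < normal H \<bullet> x}"
  using assms by (simp add: cell_def linorder_neq_iff) blast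

lemma hyperplane_arrangementD:
  assumes "hyperplane_arrangement A"
  shows "finite A" "H \<in> A \<Longrightarrow> linear_hyperplane H"
  using assms by (auto simp: hyperplane_arrangement_def)

text \<open>The nonempty open cells are open, connected and pairwise disjoint and cover the
  complement of the hyperplanes, so they are its components.\<close>

lemma regions_eq:
  assumes A: "hyperplane_arrangement A"
  shows "regions A = closed_cell UNIV A ` {P. P \<subseteq> A \<and> cell UNIV A P \<noteq> {}}"
proof -
  note fin = hyperplane_arrangementD(1)[OF A]
  note mem = mem_linear_hyperplane_iff[OF hyperplane_arrangementD(2)[OF A]]
  let ?C = "cell UNIV A ` {P. P \<subseteq> A \<and> cell UNIV A P \<noteq> {}}"
  have "components (- \<Union>A) = ?C"
  proof (rule components_open_unique)
    show "pairwise disjnt ?C"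
    proof (rule pairwiseI)
      fix X Y assume XY: "X \<in> ?C" "Y \<in> ?C" "X \<noteq> Y"
      then obtain P Q where PQ: "P \<subseteq> A" "X = cell UNIV A P" "Q \<subseteq> A" "Y = cell UNIV A Q"
        by blast
      with XY(3) have "P \<noteq> Q" by blast
      have False if x: "x \<in> X" "x \<in> Y" for x
      proof -
        have "P = {H \<in> A. 0 < normal H \<bullet> x}" "Q = {H \<in> A. 0 < normal H \<bullet> x}"
          using cell_eqI[OF x(1)[unfolded PQ(2)] PQ(1)] cell_eqI[OF x(2)[unfolded PQ(4)] PQ(3)] .
        then have "P = Q" by (rule trans[OF _ sym])
        then show False using \<open>P \<noteq> Q\<close> by contradiction
      qed
      then show "disjnt X Y"
        unfolding disjnt_iff by blast
    qed
    show "\<Union>?C = - \<Union>A"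
    proof (intro equalityI subsetI)
      fix x assume "x \<in> \<Union>?C"
      then obtain P where x: "x \<in> cell UNIV A P" by blast
      have "x \<notin> H" if "H \<in> A" for H
        using cellD[OF x that] mem[OF that, of x] by (auto split: if_splits)
      then show "x \<in> - \<Union>A" by blast
    next
      fix x assume "x \<in> - \<Union>A"
      then have "x \<in> cell UNIV A {H \<in> A. 0 < normal H \<bullet> x}"
        using mem by (intro mem_cell_positive) blast+
      then show "x \<in> \<Union>?C"
        by (intro UnionI[of "cell UNIV A {H \<in> A. 0 < normal H \<bullet> x}"] imageI CollectI conjI) auto
    qed
    show "open X \<and> connected X \<and> X \<noteq> {}" if "X \<in> ?C" for X
      using that open_cell_UNIV[OF fin] by (auto intro!: convex_connected convex_cell)
  qed
  then have "regions A = (\<lambda>P. closure (cell UNIV A P)) ` {P. P \<subseteq> A \<and> cell UNIV A P \<noteq> {}}"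
    by (simp add: regions_def image_image)
  also have "\<dots> = closed_cell UNIV A ` {P. P \<subseteq> A \<and> cell UNIV A P \<noteq> {}}"
    using closure_cell[OF subspace_UNIV fin] by (intro image_cong[OF refl]) blast
  finally show ?thesis .
qed

text \<open>Hyperplanes through \<open>p\<close> confine two-sided directions to themselves; the
  inequalities of all others are strict at \<open>p\<close> and survive a small step.\<close>

lemma face_space_closed_cell:
  assumes A: "hyperplane_arrangement A" and p: "p \<in> closed_cell UNIV A P"
  shows "face_space (closed_cell UNIV A P) p = \<Inter>{H \<in> A. p \<in> H}"
proof (intro equalityI subsetI InterI)
  note mem = mem_linear_hyperplane_iff[OF hyperplane_arrangementD(2)[OF A]]
  {
    fix v H assume v: "v \<in> face_space (closed_cell UNIV A P) p" and H: "H \<in> {H \<in> A. p \<in> H}"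
    then obtain e where e: "e > 0" "p + e *\<^sub>R v \<in> closed_cell UNIV A P" "p - e *\<^sub>R v \<in> closed_cell UNIV A P"
      by (auto simp: face_space_def)
    have "normal H \<bullet> p = 0" using H mem by blast
    then have "e * (normal H \<bullet> v) = 0"
      using closed_cellD[OF e(2), of H] closed_cellD[OF e(3), of H] H
      by (cases "H \<in> P") (simp_all add: inner_add_right inner_diff_right)
    then show "v \<in> H" using e(1) H mem by auto
  }
  fix v assume v: "v \<in> \<Inter>{H \<in> A. p \<in> H}"
  let ?B = "{H \<in> A. p \<notin> H}"
  have "p \<in> cell UNIV ?B P"
    using p mem by (auto simp: cell_def closed_cell_def order.order_iff_strict)
  then obtain e where e: "e > 0" "p + e *\<^sub>R v \<in> cell UNIV ?B P" "p - e *\<^sub>R v \<in> cell UNIV ?B P"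
    using cell_perturb[OF subspace_UNIV, of ?B p P v] hyperplane_arrangementD(1)[OF A] by auto
  have "x \<in> closed_cell UNIV A P" if x: "x \<in> cell UNIV ?B P" "\<And>H. H \<in> A \<Longrightarrow> p \<in> H \<Longrightarrow> normal H \<bullet> x = 0" for x
    unfolding closed_cell_def
  proof (intro CollectI conjI UNIV_I ballI)
    fix H assume "H \<in> A"
    then show "if H \<in> P then 0 \<le> normal H \<bullet> x else normal H \<bullet> x \<le> 0"
      using x by (cases "p \<in> H") (auto simp: cell_def less_imp_le)
  qed
  moreover have "normal H \<bullet> (p + e *\<^sub>R v) = 0" "normal H \<bullet> (p - e *\<^sub>R v) = 0" if "H \<in> A" "p \<in> H" for H
    using that v mem[OF that(1)] by (auto simp: inner_add_right inner_diff_right)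
  ultimately show "v \<in> face_space (closed_cell UNIV A P) p"
    using e unfolding face_space_def by blast
qed

text \<open>On \<open>K\<close>, the inequalities of hyperplanes containing \<open>K\<close> hold
  trivially.\<close>

lemma closed_cell_Int_subspace:
  assumes A: "hyperplane_arrangement A"
  shows "closed_cell UNIV A P \<inter> K = closed_cell K (transversal A K) (P \<inter> transversal A K)"
proof (intro equalityI subsetI)
  fix x assume x: "x \<in> closed_cell K (transversal A K) (P \<inter> transversal A K)"
  have "if H \<in> P then 0 \<le> normal H \<bullet> x else normal H \<bullet> x \<le> 0" if H: "H \<in> A" for H
  proof (cases "K \<subseteq> H")
    case True
    then have "normal H \<bullet> x = 0"
      using x mem_linear_hyperplane_iff[OF hyperplane_arrangementD(2)[OF A H]]
      by (auto simp: closed_cell_def)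
    then show ?thesis by simp
  next
    case False
    then show ?thesis
      using x H by (auto simp: closed_cell_def transversal_def split: if_splits)
  qed
  then show "x \<in> closed_cell UNIV A P \<inter> K"
    using x by (auto simp: closed_cell_def)
qed (auto simp: closed_cell_def transversal_def split: if_splits)

lemma transversal_Inter:
  "transversal A (\<Inter>{H \<in> A. p \<in> H}) = {H \<in> A. p \<notin> H}"
  by (auto simp: transversal_def)

text \<open>A face of a convex set is cut out by its affine hull. Here this is the span, hence the
  direction space at \<open>p\<close>, which is the flat \<open>K\<close>.\<close>

lemma face_of_closed_cell:
  fixes A :: "'a::euclidean_space set set"
  assumes A: "hyperplane_arrangement A" and F: "F face_of closed_cell UNIV A P"
    and p: "p \<in> rel_interior F"
  defines "K \<equiv> \<Inter>{H \<in> A. p \<in> H}"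
  shows "span F = K" "F = closed_cell K (transversal A K) (P \<inter> transversal A K)"
    "p \<in> cell K (transversal A K) (P \<inter> transversal A K)"
proof -
  let ?C = "closed_cell UNIV A P"
  have C: "polyhedral_cone ?C"
    by (intro polyhedral_cone_closed_cell hyperplane_arrangementD(1)[OF A] subspace_UNIV)
  have pF: "p \<in> F" using p rel_interior_subset by blast
  then have pC: "p \<in> ?C" using F face_of_imp_subset by blast
  show span: "span F = K"
    using face_space_polyhedral_cone[OF C F p] face_space_closed_cell[OF A pC] by (simp add: K_def)
  have 0: "0 \<in> F" using face_of_contains_0[OF C F] pF by blast
  have "F = affine hull F \<inter> ?C"
    using face_of_imp_eq_affine_Int[OF polyhedral_coneD(5)[OF C] F] .
  also have "affine hull F = K"
    using 0 span by (simp add: affine_hull_span_0 hull_inc)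
  finally show "F = closed_cell K (transversal A K) (P \<inter> transversal A K)"
    using closed_cell_Int_subspace[OF A] by (simp add: Int_commute)
  have "normal H \<bullet> p \<noteq> 0" if "H \<in> transversal A K" for H
    using that mem_linear_hyperplane_iff[OF hyperplane_arrangementD(2)[OF A]]
    unfolding K_def transversal_Inter by blast
  then have "if H \<in> P \<inter> transversal A K then 0 < normal H \<bullet> p else normal H \<bullet> p < 0"
    if "H \<in> transversal A K" for H
    using that closed_cellD[OF pC, of H]
    by (cases "H \<in> P") (auto simp: transversal_def order.order_iff_strict)
  moreover have "p \<in> K" by (auto simp: K_def)
  ultimately show "p \<in> cell K (transversal A K) (P \<inter> transversal A K)"
    unfolding cell_def by blast
qed

section \<open>Faces labelled by a flat and a sign pattern\<close>

lemma arrangement_complement_nonempty: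
  fixes A :: "'a::euclidean_space set set"
  assumes A: "hyperplane_arrangement A"
  shows "\<Union>A \<noteq> UNIV"
proof
  assume "\<Union>A = UNIV"
  moreover have "negligible H" if "H \<in> A" for H
    using negligible_hyperplane[of "normal H" 0] normal[OF hyperplane_arrangementD(2)[OF A that]] by simp
  then have "negligible (\<Union>A)"
    using hyperplane_arrangementD(1)[OF A] by (intro negligible_Union) auto
  ultimately show False
    using non_negligible_UNIV by metis
qed

text \<open>A point of an open cell of \<open>K\<close> lies on no transversal hyperplane, so the
  hyperplanes through it are exactly those containing \<open>K\<close>.\<close>

lemma intersection_lattice_eq_Inter:
  assumes A: "hyperplane_arrangement A" and K: "K \<in> intersection_lattice A"
    and p: "p \<in> cell K (transversal A K) Q"
  shows "K = \<Inter>{H \<in> A. p \<in> H}"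
proof -
  obtain S where S: "S \<subseteq> A" "K = \<Inter>S"
    using K by (auto simp: intersection_lattice_def)
  have "p \<in> K" using p by (simp add: cell_def)
  moreover have "K \<subseteq> H" if "H \<in> A" "p \<in> H" for H
  proof (rule ccontr)
    assume "\<not> K \<subseteq> H"
    then have "normal H \<bullet> p \<noteq> 0"
      using p that by (auto simp: cell_def transversal_def split: if_splits)
    then show False
      using mem_linear_hyperplane_iff[OF hyperplane_arrangementD(2)[OF A]] that by blast
  qed
  ultimately show ?thesis using S by blast
qed

lemma subspace_intersection_lattice:
  assumes A: "hyperplane_arrangement A" and K: "K \<in> intersection_lattice A"
  shows "subspace K"
  using assms subspace_linear_hyperplane hyperplane_arrangementD(2)[OF A]
  by (auto simp: intersection_lattice_def intro!: subspace_Inter)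

definition face_labels :: "'a::euclidean_space set set \<Rightarrow> nat \<Rightarrow> ('a set \<times> 'a set set) set" where
  "face_labels A j = (SIGMA K:{K \<in> intersection_lattice A. dim K = j}.
     {P \<in> Pow (transversal A K). cell K (transversal A K) P \<noteq> {}})"

text \<open>A relative interior point of a face determines its label. Conversely, pushing a point
  \<open>p\<close> of an open cell of \<open>K\<close> off all hyperplanes selects a region having
  the closed cell as a face.\<close>

lemma region_faces_eq:
  fixes A :: "'a::euclidean_space set set"
  assumes A: "hyperplane_arrangement A"
  shows "region_faces A j = (\<lambda>(K, P). closed_cell K (transversal A K) P) ` face_labels A j"
proof (intro equalityI subsetI)
  fix F assume "F \<in> region_faces A j"
  then obtain P where P: "P \<subseteq> A" "F \<in> cone_faces j (closed_cell UNIV A P)"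
    by (auto simp: region_faces_def regions_eq[OF A])
  let ?C = "closed_cell UNIV A P"
  have "polyhedral_cone ?C"
    by (intro polyhedral_cone_closed_cell hyperplane_arrangementD(1)[OF A] subspace_UNIV)
  then have F: "F face_of ?C" "F \<noteq> {}" "dim F = j"
    using P by (auto simp: cone_faces_def cone_face_iff)
  then obtain p where p: "p \<in> rel_interior F"
    using rel_interior_eq_empty face_of_imp_convex by blast
  define K where "K = \<Inter>{H \<in> A. p \<in> H}"
  note * = face_of_closed_cell[OF A F(1) p, folded K_def]
  have "K \<in> intersection_lattice A" by (auto simp: K_def intersection_lattice_def)
  moreover have "dim K = j" using *(1) F(3) dim_span by metis
  ultimately have "(K, P \<inter> transversal A K) \<in> face_labels A j"
    using *(3) by (auto simp: face_labels_def)
  then show "F \<in> (\<lambda>(K, P). closed_cell K (transversal A K) P) ` face_labels A j"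
    using *(2) by force
next
  fix F assume "F \<in> (\<lambda>(K, P). closed_cell K (transversal A K) P) ` face_labels A j"
  then obtain K Q p where K: "K \<in> intersection_lattice A" "dim K = j" and Q: "Q \<subseteq> transversal A K"
    and p: "p \<in> cell K (transversal A K) Q" and F: "F = closed_cell K (transversal A K) Q"
    by (auto simp: face_labels_def)
  note mem = mem_linear_hyperplane_iff[OF hyperplane_arrangementD(2)[OF A]]
  note fin = hyperplane_arrangementD(1)[OF A]
  have K_eq: "K = \<Inter>{H \<in> A. p \<in> H}" using intersection_lattice_eq_Inter[OF A K(1) p] .
  \<comment> \<open>A small move along \<open>u\<close> leaves every hyperplane through
    \<open>p\<close> and keeps the signs at all others.\<close>
  obtain u where u: "u \<notin> \<Union>A" using arrangement_complement_nonempty[OF A] by blast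
  have "p \<in> cell UNIV (transversal A K) Q" using p by (simp add: cell_def)
  then obtain e where e: "e > 0" "p + e *\<^sub>R u \<in> cell UNIV (transversal A K) Q"
    using cell_perturb[OF subspace_UNIV finite_transversal[OF fin] _ UNIV_I] by blast
  define x where "x = p + e *\<^sub>R u"
  define P where "P = {H \<in> A. 0 < normal H \<bullet> x}"
  have "normal H \<bullet> x \<noteq> 0" if H: "H \<in> A" for H
  proof (cases "p \<in> H")
    case True
    then show ?thesis using mem[OF H] u H e(1) by (auto simp: x_def inner_add_right)
  next
    case False
    then have "H \<in> transversal A K" using H by (subst K_eq) (simp add: transversal_Inter)
    then show ?thesis using e(2) by (auto simp: cell_def x_def split: if_splits)
  qed
  then have xP: "x \<in> cell UNIV A P" unfolding P_def by (intro mem_cell_positive) auto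
  have "Q = {H \<in> transversal A K. 0 < normal H \<bullet> x}"
    using cell_eqI[OF e(2) Q] by (simp add: x_def)
  then have PQ: "P \<inter> transversal A K = Q"
    by (auto simp: P_def transversal_def)
  let ?C = "closed_cell UNIV A P"
  have C: "polyhedral_cone ?C"
    by (intro polyhedral_cone_closed_cell fin subspace_UNIV)
  have "p \<in> closed_cell K (transversal A K) Q"
    using p cell_subset_closed_cell by blast
  then have "p \<in> ?C" using closed_cell_Int_subspace[OF A, of P K] PQ by blast
  \<comment> \<open>The face of this region with \<open>p\<close> in its relative interior has the
    label \<open>(K, Q)\<close>, so it is \<open>F\<close>.\<close>
  then obtain F' where F': "F' face_of ?C" "p \<in> rel_interior F'"
    using polyhedron_point_in_rel_interior_face[OF polyhedral_coneD(1)[OF C]] by blast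
  note * = face_of_closed_cell[OF A F', folded K_eq, unfolded PQ]
  have "F' = F" using * F by simp
  moreover have "dim F' = j" using *(1) K(2) dim_span by metis
  moreover have "F' \<noteq> {}" using F'(2) rel_interior_subset by blast
  ultimately have "F \<in> cone_faces j ?C"
    using F' C by (auto simp: cone_faces_def cone_face_iff)
  moreover have "?C \<in> regions A"
    unfolding regions_eq[OF A] using xP by (auto simp: P_def)
  ultimately show "F \<in> region_faces A j"
    by (auto simp: region_faces_def)
qed

lemma span_closed_cell:
  assumes K: "subspace K" and A: "finite A" and x: "x \<in> cell K A P"
  shows "span (closed_cell K A P) = K"
proof (intro equalityI subsetI)
  show "v \<in> K" if "v \<in> span (closed_cell K A P)" for v
    using that span_minimal[OF _ K, of "closed_cell K A P"] by (auto simp: closed_cell_def)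
  fix v assume "v \<in> K"
  then obtain e where e: "e > 0" "x + e *\<^sub>R v \<in> cell K A P"
    using cell_perturb[OF K A x] by metis
  have "(1/e) *\<^sub>R ((x + e *\<^sub>R v) - x) \<in> span (closed_cell K A P)"
    using e x cell_subset_closed_cell by (intro span_scale span_diff span_base) blast+
  then show "v \<in> span (closed_cell K A P)" using e(1) by simp
qed

text \<open>The flat is recovered as the span. For the signs, a point of one open cell lies in the
  other closed cell, and its strict signs are incompatible with opposite weak ones.\<close>

lemma inj_on_closed_cell_face_labels:
  assumes A: "hyperplane_arrangement A"
  shows "inj_on (\<lambda>(K, P). closed_cell K (transversal A K) P) (face_labels A j)"
proof (rule inj_onI, clarify)
  fix K P L Q
  assume KP: "(K, P) \<in> face_labels A j" and LQ: "(L, Q) \<in> face_labels A j"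
    and eq: "closed_cell K (transversal A K) P = closed_cell L (transversal A L) Q"
  note fin = finite_transversal[OF hyperplane_arrangementD(1)[OF A]]
  obtain x where x: "x \<in> cell K (transversal A K) P"
    using KP by (auto simp: face_labels_def)
  obtain y where y: "y \<in> cell L (transversal A L) Q"
    using LQ by (auto simp: face_labels_def)
  have K: "subspace K" "subspace L"
    using KP LQ subspace_intersection_lattice[OF A] by (auto simp: face_labels_def)
  have [simp]: "L = K"
    using span_closed_cell[OF K(1) fin x] span_closed_cell[OF K(2) fin y] eq by simp
  have PQ: "P \<subseteq> transversal A K" "Q \<subseteq> transversal A K"
    using KP LQ by (auto simp: face_labels_def)
  have sub: "P \<subseteq> Q" if "closed_cell K (transversal A K) P = closed_cell K (transversal A K) Q"
    "x \<in> cell K (transversal A K) P" "P \<subseteq> transversal A K" for P Q x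
  proof
    fix H assume H: "H \<in> P"
    have "x \<in> closed_cell K (transversal A K) Q"
      unfolding that(1)[symmetric] using that(2) cell_subset_closed_cell by blast
    then show "H \<in> Q"
      using H that(3) cellD[OF that(2), of H] closed_cellD[of x K "transversal A K" Q H]
      by (auto split: if_splits)
  qed
  have "P = Q"
    using sub[of P Q x] sub[of Q P y] x y eq PQ by auto
  then show "K = L \<and> P = Q" by simp
qed

lemma sum_intrinsic_volume_region_faces:
  fixes A :: "'a::euclidean_space set set"
  assumes A: "hyperplane_arrangement A"
  shows "(\<Sum>F\<in>region_faces A j. intrinsic_volume k F) = (-1) ^ (j + k) * coeff (level_char_poly A j) k"
proof -
  note fin = hyperplane_arrangementD(1)[OF A]
  let ?L = "{K \<in> intersection_lattice A. dim K = j}"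
  have "(\<Sum>F\<in>region_faces A j. intrinsic_volume k F) =
      (\<Sum>(K, P)\<in>face_labels A j. intrinsic_volume k (closed_cell K (transversal A K) P))"
    unfolding region_faces_eq[OF A] sum.reindex[OF inj_on_closed_cell_face_labels[OF A]]
    by (simp add: comp_def case_prod_unfold)
  also have "\<dots> = (\<Sum>K\<in>?L. \<Sum>P\<in>{P \<in> Pow (transversal A K). cell K (transversal A K) P \<noteq> {}}.
      intrinsic_volume k (closed_cell K (transversal A K) P))"
    unfolding face_labels_def using finite_intersection_lattice[OF fin] finite_transversal[OF fin]
    by (intro sum.Sigma[symmetric]) auto
  \<comment> \<open>The sign patterns of empty cells are added with the value 0.\<close>
  also have "\<dots> = (\<Sum>K\<in>?L. \<Sum>P\<in>Pow (transversal A K). cell_volume k K (transversal A K) P)"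
    by (intro sum.cong[OF refl] sum.mono_neutral_cong_left)
      (auto simp: cell_volume_def finite_transversal[OF fin])
  also have "\<dots> = (\<Sum>K\<in>?L. (-1) ^ (j + k) *
      (\<Sum>B\<in>Pow (transversal A K). if dim (K \<inter> \<Inter>B) = k then (-1) ^ card B else 0))"
    using subspace_intersection_lattice[OF A] hyperplane_arrangementD(2)[OF A]
    by (intro sum.cong refl, subst sum_cell_volume)
      (auto simp: finite_transversal[OF fin], auto simp: transversal_def)
  also have "\<dots> = (-1) ^ (j + k) * coeff (level_char_poly A j) k"
    unfolding coeff_level_char_poly[OF fin] sum_distrib_left ..
  finally show ?thesis .
qed

theorem theorem6p1:
  fixes A :: "'a::euclidean_space set set" and j :: nat
  assumes "hyperplane_arrangement A" and "j \<le> DIM('a)"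
  shows "(\<forall>t::real. (\<Sum>F\<in>region_faces A j. poly (intrinsic_volume_poly F) t)
              = (-1) ^ j * poly (level_char_poly A j) (- t))
       \<and> (\<forall>k\<le>j. (\<Sum>F\<in>region_faces A j. intrinsic_volume k F)
              = (-1) ^ (j - k) * coeff (level_char_poly A j) k)"
proof (intro conjI allI impI)
  note sum_eq = sum_intrinsic_volume_region_faces[OF assms(1), of _ j]
  fix t :: real
  let ?\<chi> = "level_char_poly A j"
  have "(\<Sum>F\<in>region_faces A j. poly (intrinsic_volume_poly F) t) =
      (\<Sum>k\<le>DIM('a). (\<Sum>F\<in>region_faces A j. intrinsic_volume k F) * t ^ k)"
    unfolding intrinsic_volume_poly_def poly_sum poly_monom sum_distrib_right by (rule sum.swap)
  also have "\<dots> = (-1) ^ j * (\<Sum>k\<le>DIM('a). coeff ?\<chi> k * (- t) ^ k)"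
    unfolding sum_eq sum_distrib_left
    by (intro sum.cong refl) (simp add: power_add power_minus[of t])
  also have "(\<Sum>k\<le>DIM('a). coeff ?\<chi> k * (- t) ^ k) = poly (\<Sum>k\<le>DIM('a). monom (coeff ?\<chi> k) k) (- t)"
    by (simp add: poly_sum poly_monom)
  \<comment> \<open>By the degree bound, the sum up to \<open>DIM('a)\<close> contains all
    coefficients.\<close>
  also have "(\<Sum>k\<le>DIM('a). monom (coeff ?\<chi> k) k) = ?\<chi>"
    using degree_level_char_poly_le[OF hyperplane_arrangementD(1)[OF assms(1)]]
    by (rule poly_as_sum_of_monoms')
  finally show "(\<Sum>F\<in>region_faces A j. poly (intrinsic_volume_poly F) t) = (-1) ^ j * poly ?\<chi> (- t)" .
next
  fix k assume "k \<le> j"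
  \<comment> \<open>For \<open>k \<le> j\<close> the subtraction is not truncated, and
    \<open>j + k\<close> and \<open>j - k\<close> have the same parity.\<close>
  then have "(-1) ^ (j + k) = ((-1) ^ (j - k) :: real)"
    by (simp add: minus_one_power_iff)
  then show "(\<Sum>F\<in>region_faces A j. intrinsic_volume k F) = (-1) ^ (j - k) * coeff (level_char_poly A j) k"
    by (simp add: sum_intrinsic_volume_region_faces[OF assms(1)])
qed

end
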